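(* Let $d\ge 1$ and let $f:\mathbb{R}\to\mathbb{C}^{d\times d}$ be a matrix-valued trigonometric polynomial such that $f(\theta)$ is Hermitian nonnegative definite for every $\theta$. Let $\Theta_0$ be the set of $\theta\in[0,2\pi)$ such that $f(\theta)$ has a zero eigenvalue, and assume that for every $\theta\in\Theta_0$ all eigenvalues of $f(\theta+\pi)$ are nonzero. Let $p:\mathbb{R}\to\mathbb{C}^{d\times d}$ be a matrix-valued trigonometric polynomial, with $p(\theta)$ diagonalizable for every $\theta$, such that: (i) there exists $\delta>0$ such that $\left|f(\theta)^{-1/2}\,p(\theta+\pi)^{H}\right|_1<\delta$ for all $\theta\in[0,2\pi)\setminus\Theta_0$; (ii) $p(\theta)^{H}p(\theta)+p(\theta+\pi)^{H}p(\theta+\pi)$ is positive definite for all $\theta\in[0,2\pi)$; (iii) $p(\theta)p(\theta+\pi)=p(\theta+\pi)p(\theta)$ for all $\theta\in[0,2\pi)$. For $n=2^t$ with $t\ge 1$ an integer, put $k=n/2$, $N=dn$, $K=dk$, $A_N=\mathcal{A}_n(f)\in\mathbb{C}^{N\times N}$ and $p_n^k=\mathcal{A}_n(p)(K_n^T\otimes I_d)\in\mathbb{C}^{N\times K}$. Then there exists $\gamma>0$ independent of $n$ such that, for every such $n$, $$\min_{y\in\mathbb{C}^{K}}\|x-p_n^k y\|_2^2\le\gamma\,\|x\|_{A_N}^2\qquad\text{for all }x\in\mathbb{C}^{N}.$$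
   Context: A matrix-valued trigonometric polynomial is a function $g(\theta)=\sum_{|j|\le r}\hat g_j e^{\iota j\theta}$ with $r$ finite, $\hat g_j\in\mathbb{C}^{d\times d}$ and $\iota^2=-1$; it is $2\pi$-periodic. Block-circulant matrix generated by $g$: with grid points $\theta_i^{(n)}=\frac{2\pi i}{n}$, $i=0,\dots,n-1$, and the Fourier matrix $F_n=\frac{1}{\sqrt n}\left[e^{-\iota j\theta_i^{(n)}}\right]_{i,j=0}^{n-1}$, $$\mathcal{A}_n(g)=(F_n\otimes I_d)\,\mathrm{diag}_{i=0,\dots,n-1}\big(g(\theta_i^{(n)})\big)\,(F_n^H\otimes I_d)\in\mathbb{C}^{dn\times dn},$$ where $\mathrm{diag}$ denotes the block-diagonal matrix with the indicated $d\times d$ diagonal blocks and $\otimes$ is the Kronecker product. Cutting matrix: $K_n$ is the $k\times n$ matrix ($k=n/2$) that keeps every other entry: with indices starting from $0$, $(K_n)_{i,j}=1$ if $j=2i$ and $(K_n)_{i,j}=0$ otherwise, for $0\le i\le k-1$, $0\le j\le n-1$. Norms: $|\cdot|_1$ is the matrix norm induced by the vector $1$-norm; $\|\cdot\|_2$ is the Euclidean norm; $\|x\|_{X}^2=\|X^{1/2}x\|_2^2=x^HXx$ for a Hermitian nonnegative definite matrix $X$. The superscript $H$ denotes conjugate transpose, and $f(\theta)^{-1/2}$ is the inverse of the Hermitian positive definite square root of $f(\theta)$, defined for $\theta\notin\Theta_0$. *)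

theory Defs
  imports
    "HOL-Analysis.L2_Norm"
    "Jordan_Normal_Form.Gauss_Jordan_Elimination"
    "Jordan_Normal_Form.Schur_Decomposition"
begin

section \<open>Vector and matrix norms\<close>

definition norm1_vec :: "complex vec \<Rightarrow> real" where
  "norm1_vec v = (\<Sum>i<dim_vec v. cmod (vec_index v i))"

definition norm2_vec :: "complex vec \<Rightarrow> real" where
  "norm2_vec v = L2_set (\<lambda>i. cmod (vec_index v i)) {..<dim_vec v}"

text \<open>
  The induced (operator) norm. If the matrix has no columns the supremum is over the empty set,
  so the definition is only meaningful for matrices with at least one column.
\<close>
definition norm1_mat :: "complex mat \<Rightarrow> real" where
  "norm1_mat A = (SUP v \<in> {v \<in> carrier_vec (dim_col A). norm1_vec v = 1}. norm1_vec (A *\<^sub>v v))"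

section \<open>Hermitian matrices\<close>

text \<open>
  Since \<open>u \<bullet>c v\<close> conjugates its second argument, \<open>(A *\<^sub>v v) \<bullet>c v\<close> is $v^H A v$. This number is
  real for Hermitian \<open>A\<close>, and \<open>Re\<close> only changes its type.
\<close>
definition quad_form :: "complex mat \<Rightarrow> complex vec \<Rightarrow> real" where
  "quad_form A v = Re ((A *\<^sub>v v) \<bullet>c v)"

definition hermitian :: "complex mat \<Rightarrow> bool" where
  "hermitian A \<longleftrightarrow> mat_adjoint A = A"

definition nonneg_definite :: "complex mat \<Rightarrow> bool" where
  "nonneg_definite A \<longleftrightarrow> hermitian A \<and> (\<forall>v \<in> carrier_vec (dim_row A). quad_form A v \<ge> 0)"

definition pos_definite :: "complex mat \<Rightarrow> bool" where
  "pos_definite A \<longleftrightarrow>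
     hermitian A \<and> (\<forall>v \<in> carrier_vec (dim_row A). v \<noteq> 0\<^sub>v (dim_row A) \<longrightarrow> quad_form A v > 0)"

text \<open>
  The squared norm \<open>\<parallel>x\<parallel>\<^sub>X\<^sup>2\<close>, i.e. $x^H X x$, for Hermitian nonnegative definite \<open>X\<close>.
\<close>
abbreviation sqnorm_wrt :: "complex mat \<Rightarrow> complex vec \<Rightarrow> real" where
  "sqnorm_wrt X x \<equiv> quad_form X x"

definition diagonalizable :: "complex mat \<Rightarrow> bool" where
  "diagonalizable A \<longleftrightarrow> (\<exists>D. diagonal_mat D \<and> similar_mat A D)"

text \<open>
  The Hermitian positive definite square root of a Hermitian positive definite matrix exists and is
  unique; for other arguments \<open>pd_sqrt\<close> and \<open>inv_sqrt\<close> are unspecified.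
\<close>
definition pd_sqrt :: "complex mat \<Rightarrow> complex mat" where
  "pd_sqrt A = (THE S. pos_definite S \<and> S * S = A)"

definition inv_sqrt :: "complex mat \<Rightarrow> complex mat" where
  "inv_sqrt A = the (mat_inverse (pd_sqrt A))"

section \<open>Matrix-valued trigonometric polynomials\<close>

text \<open>
  \<open>c j\<close> is the Fourier coefficient with index \<open>j\<close>. The sum is taken entrywise because there is no
  zero, hence no \<open>sum\<close>, on the type of matrices of all sizes.
\<close>
definition trig_poly :: "nat \<Rightarrow> (real \<Rightarrow> complex mat) \<Rightarrow> bool" where
  "trig_poly d g \<longleftrightarrow>
     (\<exists>(r::nat) (c :: int \<Rightarrow> complex mat).
        (\<forall>j. c j \<in> carrier_mat d d) \<and>
        (\<forall>\<theta>. g \<theta> = mat d d (\<lambda>(a, b).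
           \<Sum>j \<in> {- int r..int r}. (c j $$ (a, b)) * exp (\<i> * of_int j * of_real \<theta>))))"

definition singular_angles :: "(real \<Rightarrow> complex mat) \<Rightarrow> real set" where
  "singular_angles f = {\<theta> \<in> {0..<2 * pi}. eigenvalue (f \<theta>) 0}"

section \<open>Block-circulant matrices and the cutting matrix\<close>

definition kronecker :: "complex mat \<Rightarrow> complex mat \<Rightarrow> complex mat" where
  "kronecker A B = mat (dim_row A * dim_row B) (dim_col A * dim_col B)
     (\<lambda>(i, j). A $$ (i div dim_row B, j div dim_col B) * B $$ (i mod dim_row B, j mod dim_col B))"

definition grid_point :: "nat \<Rightarrow> nat \<Rightarrow> real" where
  "grid_point n i = 2 * pi * real i / real n"

definition fourier_mat :: "nat \<Rightarrow> complex mat" where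
  "fourier_mat n = mat n n
     (\<lambda>(i, j). exp (- \<i> * of_nat j * of_real (grid_point n i)) / of_real (sqrt (real n)))"

definition block_circulant :: "nat \<Rightarrow> nat \<Rightarrow> (real \<Rightarrow> complex mat) \<Rightarrow> complex mat" where
  "block_circulant d n g =
     kronecker (fourier_mat n) (1\<^sub>m d)
     * diag_block_mat (map (\<lambda>i. g (grid_point n i)) [0..<n])
     * kronecker (mat_adjoint (fourier_mat n)) (1\<^sub>m d)"

definition cutting_mat :: "nat \<Rightarrow> complex mat" where
  "cutting_mat n = mat (n div 2) n (\<lambda>(i, j). if j = 2 * i then 1 else 0)"

definition prolongation :: "nat \<Rightarrow> nat \<Rightarrow> (real \<Rightarrow> complex mat) \<Rightarrow> complex mat" where
  "prolongation d n p =
     block_circulant d n p * kronecker (transpose_mat (cutting_mat n)) (1\<^sub>m d)"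

end

theory Submission
  imports Defs "Jordan_Normal_Form.Spectral_Radius"
begin

text \<open>
  The Fourier matrix splits the least squares problem into independent ones, one for each pair of
  frequencies \<open>\<theta>, \<theta> + \<pi>\<close>: the range of the prolongation becomes that of the
  $2d \times d$ matrix with blocks $P = p(\theta)$ and $Q = p(\theta + \pi)$. Since $P$ and $Q$ commute,
  the orthogonal complement of this range is the range of the matrix with blocks $Q^H$ and $-P^H$,
  and the residual of a pair $(x, y)$ has the blocks $\pm Q^H T (Q x - P y)$ and $\pm P^H T (Q x - P y)$,
  where $T = (P P^H + Q Q^H)^{-1}$ is a continuous function of $\theta$, hence bounded. Finally
  $|Q x|^2 \le C\, x^H f(\theta) x$ by the first hypothesis on $p$; this extends by continuity to
  the singular angles, which are finite in number because $\det f$ is a nonzero trigonometric polynomial.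
\<close>

section \<open>Adjoints, norms and quadratic forms\<close>

text \<open>The normal equations need only the inverse of the column Gram matrix P^H P + Q^H Q,
  which hypothesis (ii) supplies. The obstacle is the estimate: a residual written with that inverse
  shows no smallness where f degenerates. Hypothesis (i) controls Q x by f(\<theta>) and, read at
  \<theta> + pi with p of period 2 pi, P y by f(\<theta> + pi), so the residual has to be expressed
  through Q x - P y. That is what brings in the row Gram matrix P P^H + Q Q^H, whose invertibility
  hypothesis (ii) does not state; it is derived from commutation and diagonalizability. Exactly
  these two frequencies meet because a vector supported on the even positions is one whose Fourier
  blocks j and j + n/2 coincide, and the grid points of the two blocks differ by pi. One w serves
  twice: the normal equations make it an exact minimiser, so the minimum is attained, and the
  residual formula bounds its value. The constant does not see n, since every bound is uniform in
  the angle and the grid only samples it.\<close>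

lemma mult_carrier_square [simp]:
  "A \<in> carrier_mat n n \<Longrightarrow> B \<in> carrier_mat n n \<Longrightarrow> A * B \<in> carrier_mat n n"
  by (rule mult_carrier_mat)

lemma mat_adjoint_eq: "mat_adjoint A = mat (dim_col A) (dim_row A) (\<lambda>(i,j). cnj (A $$ (j,i)))"
  for A :: "complex mat"
  unfolding mat_adjoint_def by (rule eq_matI) (auto simp: mat_of_rows_def)

lemma mat_adjoint_dim [simp]: "dim_row (mat_adjoint A) = dim_col A" "dim_col (mat_adjoint A) = dim_row A"
  for A :: "complex mat"
  by (auto simp: mat_adjoint_eq)

lemma mat_adjoint_index [simp]:
  "i < dim_col A \<Longrightarrow> j < dim_row A \<Longrightarrow> mat_adjoint A $$ (i,j) = cnj (A $$ (j,i))"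
  for A :: "complex mat"
  by (subst mat_adjoint_eq) simp

lemma mat_adjoint_carrier [simp, intro]: "A \<in> carrier_mat n m \<Longrightarrow> mat_adjoint A \<in> carrier_mat m n"
  for A :: "complex mat"
  by (rule carrier_matI) simp_all

lemma mat_adjoint_adjoint [simp]: "mat_adjoint (mat_adjoint A) = A" for A :: "complex mat"
  by (rule eq_matI) auto

lemma mat_adjoint_one [simp]: "mat_adjoint (1\<^sub>m n) = (1\<^sub>m n :: complex mat)"
  by (rule eq_matI) auto

lemma mat_adjoint_mult:
  "A \<in> carrier_mat n m \<Longrightarrow> B \<in> carrier_mat m k \<Longrightarrow> mat_adjoint (A * B) = mat_adjoint B * mat_adjoint A"
  for A B :: "complex mat"
  by (rule eq_matI) (auto simp: scalar_prod_def intro!: sum.cong)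

lemma mat_adjoint_add:
  "A \<in> carrier_mat n m \<Longrightarrow> B \<in> carrier_mat n m \<Longrightarrow> mat_adjoint (A + B) = mat_adjoint A + mat_adjoint B"
  for A B :: "complex mat"
  by (rule eq_matI) auto

lemma mat_adjoint_minus:
  "A \<in> carrier_mat n m \<Longrightarrow> B \<in> carrier_mat n m \<Longrightarrow> mat_adjoint (A - B) = mat_adjoint A - mat_adjoint B"
  for A B :: "complex mat"
  by (rule eq_matI) auto

lemma cscalar_prod_sum: "u \<bullet>c v = (\<Sum>i<dim_vec v. u $ i * cnj (v $ i))" for u v :: "complex vec"
  by (auto simp: scalar_prod_def atLeast0LessThan)

lemma cscalar_prod_adjoint:
  fixes A :: "complex mat"
  assumes "A \<in> carrier_mat n m" "u \<in> carrier_vec m" "v \<in> carrier_vec n"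
  shows "(A *\<^sub>v u) \<bullet>c v = u \<bullet>c (mat_adjoint A *\<^sub>v v)"
proof -
  have "(A *\<^sub>v u) \<bullet>c v = (\<Sum>i<n. \<Sum>j<m. A $$ (i,j) * u $ j * cnj (v $ i))"
    using assms by (auto simp: cscalar_prod_sum scalar_prod_def atLeast0LessThan sum_distrib_right intro!: sum.cong)
  also have "\<dots> = (\<Sum>j<m. \<Sum>i<n. A $$ (i,j) * u $ j * cnj (v $ i))"
    by (rule sum.swap)
  also have "\<dots> = u \<bullet>c (mat_adjoint A *\<^sub>v v)"
    using assms by (auto simp: cscalar_prod_sum scalar_prod_def atLeast0LessThan sum_distrib_left intro!: sum.cong)
  finally show ?thesis .
qed

lemma norm2_vec_sq: "(norm2_vec v)\<^sup>2 = (\<Sum>i<dim_vec v. (cmod (v $ i))\<^sup>2)"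
  by (simp add: norm2_vec_def L2_set_def sum_nonneg)

lemma norm2_vec_cscalar: "complex_of_real ((norm2_vec v)\<^sup>2) = v \<bullet>c v"
  unfolding norm2_vec_sq cscalar_prod_sum of_real_sum
  by (intro sum.cong refl) (simp only: complex_norm_square)

lemma norm2_vec_cscalar_Re: "(norm2_vec v)\<^sup>2 = Re (v \<bullet>c v)"
  by (metis norm2_vec_cscalar Re_complex_of_real)

lemma norm2_vec_eq_0: "v \<in> carrier_vec n \<Longrightarrow> (norm2_vec v)\<^sup>2 = 0 \<longleftrightarrow> v = 0\<^sub>v n"
  by (metis norm2_vec_cscalar conjugate_square_eq_0_vec of_real_eq_0_iff)

lemma cscalar_prod_commute:
  "dim_vec u = dim_vec v \<Longrightarrow> v \<bullet>c u = cnj (u \<bullet>c v)" for u v :: "complex vec"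
  by (simp add: cscalar_prod_sum mult.commute)

lemma cscalar_prod_add_left: "u \<in> carrier_vec n \<Longrightarrow> v \<in> carrier_vec n \<Longrightarrow> w \<in> carrier_vec n \<Longrightarrow>
   (u + v) \<bullet>c w = u \<bullet>c w + v \<bullet>c w" for u v w :: "complex vec"
  by (simp add: cscalar_prod_sum algebra_simps sum.distrib)

lemma norm2_vec_add_sq:
  assumes "u \<in> carrier_vec n" "v \<in> carrier_vec n"
  shows "(norm2_vec (u + v))\<^sup>2 = (norm2_vec u)\<^sup>2 + (norm2_vec v)\<^sup>2 + 2 * Re (u \<bullet>c v)"
proof -
  have "(cmod (a + b))\<^sup>2 = (cmod a)\<^sup>2 + (cmod b)\<^sup>2 + 2 * Re (a * cnj b)" for a b
    by (simp add: cmod_power2) (simp add: power2_eq_square algebra_simps)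
  then show ?thesis using assms
    by (simp add: norm2_vec_sq cscalar_prod_sum sum.distrib sum_distrib_left)
qed

lemma norm2_vec_add_sq_le:
  assumes "u \<in> carrier_vec n" "v \<in> carrier_vec n"
  shows "(norm2_vec (u + v))\<^sup>2 \<le> 2 * (norm2_vec u)\<^sup>2 + 2 * (norm2_vec v)\<^sup>2"
proof -
  have "(cmod (a + b))\<^sup>2 \<le> 2 * (cmod a)\<^sup>2 + 2 * (cmod b)\<^sup>2" for a b
  proof -
    have "(cmod (a + b))\<^sup>2 + (cmod (a - b))\<^sup>2 = 2 * (cmod a)\<^sup>2 + 2 * (cmod b)\<^sup>2"
      by (simp add: cmod_power2) (simp add: power2_eq_square algebra_simps)
    then show ?thesis using zero_le_power2[of "cmod (a - b)"] by linarith
  qed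
  then have "(\<Sum>i<n. (cmod (u $ i + v $ i))\<^sup>2) \<le> (\<Sum>i<n. 2 * (cmod (u $ i))\<^sup>2 + 2 * (cmod (v $ i))\<^sup>2)"
    by (intro sum_mono) blast
  then show ?thesis using assms
    by (simp add: norm2_vec_sq sum_distrib_left sum.distrib)
qed

lemma norm2_vec_zero [simp]: "norm2_vec (0\<^sub>v n) = 0"
  by (simp add: norm2_vec_def L2_set_def)

lemma norm2_vec_uminus [simp]: "norm2_vec (- v) = norm2_vec v"
  by (simp add: norm2_vec_def L2_set_def)

lemma quad_form_adjoint_mult:
  assumes "A \<in> carrier_mat n m" "v \<in> carrier_vec m"
  shows "quad_form (mat_adjoint A * A) v = (norm2_vec (A *\<^sub>v v))\<^sup>2"
proof -
  have "(mat_adjoint A * A *\<^sub>v v) \<bullet>c v = (mat_adjoint A *\<^sub>v (A *\<^sub>v v)) \<bullet>c v"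
    using assms by (metis assoc_mult_mat_vec mat_adjoint_carrier)
  also have "\<dots> = (A *\<^sub>v v) \<bullet>c (A *\<^sub>v v)"
    using cscalar_prod_adjoint[of "mat_adjoint A" m n "A *\<^sub>v v" v] assms by simp
  finally show ?thesis by (simp add: quad_form_def norm2_vec_cscalar_Re)
qed

lemma quad_form_add:
  assumes "A \<in> carrier_mat n n" "B \<in> carrier_mat n n" "v \<in> carrier_vec n"
  shows "quad_form (A + B) v = quad_form A v + quad_form B v"
  using assms by (simp add: quad_form_def add_mult_distrib_mat_vec[of A n n B] cscalar_prod_add_left[of _ n])

text \<open>Cauchy-Schwarz in each row: n * m * c^2 bounds the squared Frobenius norm. This crude
  bound fits, because the matrices in question are controlled through their entries, by continuity
  or by \<open>norm1_mat\<close>.\<close>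

lemma norm2_mult_mat_vec_le:
  assumes A: "A \<in> carrier_mat n m" and v: "v \<in> carrier_vec m"
    and c: "\<And>i j. i < n \<Longrightarrow> j < m \<Longrightarrow> cmod (A $$ (i,j)) \<le> c"
  shows "(norm2_vec (A *\<^sub>v v))\<^sup>2 \<le> real n * real m * c\<^sup>2 * (norm2_vec v)\<^sup>2"
proof -
  have "(cmod ((A *\<^sub>v v) $ i))\<^sup>2 \<le> real m * c\<^sup>2 * (norm2_vec v)\<^sup>2" if i: "i < n" for i
  proof -
    have "cmod ((A *\<^sub>v v) $ i) = cmod (\<Sum>j<m. A $$ (i,j) * v $ j)"
      using A v i by (simp add: scalar_prod_def atLeast0LessThan)
    also have "\<dots> \<le> (\<Sum>j<m. cmod (A $$ (i,j)) * cmod (v $ j))"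
      by (rule order_trans[OF norm_sum]) (simp add: norm_mult)
    finally have "(cmod ((A *\<^sub>v v) $ i))\<^sup>2 \<le> (\<Sum>j<m. cmod (A $$ (i,j)) * cmod (v $ j))\<^sup>2"
      by (rule power_mono) simp
    also have "\<dots> \<le> (\<Sum>j<m. (cmod (A $$ (i,j)))\<^sup>2) * (\<Sum>j<m. (cmod (v $ j))\<^sup>2)"
    proof -
      have "(\<Sum>j<m. cmod (A $$ (i,j)) * cmod (v $ j))
          \<le> L2_set (\<lambda>j. cmod (A $$ (i,j))) {..<m} * L2_set (\<lambda>j. cmod (v $ j)) {..<m}"
        using L2_set_mult_ineq[of "\<lambda>j. cmod (A $$ (i,j))" "\<lambda>j. cmod (v $ j)" "{..<m}"] by simp
      then have "(\<Sum>j<m. cmod (A $$ (i,j)) * cmod (v $ j))\<^sup>2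
          \<le> (L2_set (\<lambda>j. cmod (A $$ (i,j))) {..<m} * L2_set (\<lambda>j. cmod (v $ j)) {..<m})\<^sup>2"
        by (intro power_mono sum_nonneg) auto
      then show ?thesis by (simp add: power_mult_distrib L2_set_def sum_nonneg)
    qed
    also have "\<dots> \<le> (\<Sum>j<m. c\<^sup>2) * (\<Sum>j<m. (cmod (v $ j))\<^sup>2)"
      by (intro mult_right_mono sum_mono power_mono sum_nonneg c) (use i in auto)
    finally show ?thesis using v by (simp add: norm2_vec_sq)
  qed
  then have "(\<Sum>i<n. (cmod ((A *\<^sub>v v) $ i))\<^sup>2) \<le> (\<Sum>i<n. real m * c\<^sup>2 * (norm2_vec v)\<^sup>2)"
    by (intro sum_mono) auto
  then show ?thesis using A by (simp add: norm2_vec_sq[of "A *\<^sub>v v"])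
qed

text \<open>The inverse is given by Cramer's rule, not merely as an existing matrix, so that for a
  matrix depending on \<theta> its entries are visibly continuous
  (\<open>entries_continuous_inverse\<close>).\<close>

lemma exists_inverse_of_det:
  assumes A: "(A :: complex mat) \<in> carrier_mat n n" and d: "det A \<noteq> 0"
  defines "B \<equiv> inverse (det A) \<cdot>\<^sub>m adj_mat A"
  shows "B \<in> carrier_mat n n" "A * B = 1\<^sub>m n" "B * A = 1\<^sub>m n"
proof -
  note adj = adj_mat[OF A]
  show "B \<in> carrier_mat n n" using adj by (simp add: B_def)
  have "inverse (det A) \<cdot>\<^sub>m (det A \<cdot>\<^sub>m 1\<^sub>m n) = (1\<^sub>m n :: complex mat)"
    using d by (intro eq_matI) auto
  then show "A * B = 1\<^sub>m n" "B * A = 1\<^sub>m n"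
    unfolding B_def using adj mult_smult_distrib[OF A adj(1)] mult_smult_assoc_mat[OF adj(1) A] by auto
qed

section \<open>The spectral theorem\<close>

lemma mat_adjoint_mat_diag: "mat_adjoint (mat_diag n f) = mat_diag n (\<lambda>i. cnj (f i))"
  by (rule eq_matI) (auto simp: mat_diag_def)

text \<open>Gram-Schmidt leaves the head of the list alone, so starting it from a basis headed by
  \<open>v\<close> keeps the direction of \<open>v\<close> in column 0. The scalar \<open>c\<close>
  absorbs the normalisation, which is harmless for an eigenvector.\<close>

lemma unit_vector_extends_to_unitary:
  assumes v: "v \<in> carrier_vec n" and v0: "v \<noteq> 0\<^sub>v n"
  shows "\<exists>W \<in> carrier_mat n n. \<exists>c. mat_adjoint W * W = 1\<^sub>m n \<and> col W 0 = c \<cdot>\<^sub>v (v :: complex vec)"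
proof -
  interpret cof_vec_space n "TYPE(complex)" .
  define b where "b = basis_completion v"
  define ws where "ws = gram_schmidt n b"
  have n: "n \<noteq> 0" using v v0 by auto
  from basis_completion[OF v v0, folded b_def]
  have dist_b: "distinct b" and indep: "\<not> lin_dep (set b)" and b: "set b \<subseteq> carrier_vec n"
    and hdb: "hd b = v" and len_b: "length b = n" by auto
  from hdb len_b n obtain vs where bv: "b = v # vs" by (cases b) auto
  from gram_schmidt_result[OF b dist_b indep refl, folded ws_def]
  have ws: "set ws \<subseteq> carrier_vec n" "corthogonal ws" "length ws = n"
    by (auto simp: len_b)
  from gram_schmidt_hd[OF v, of vs, folded bv] have "hd ws = v" unfolding ws_def .
  then have ws0: "ws ! 0 = v" using ws n by (cases ws) auto
  have wsc: "ws ! i \<in> carrier_vec n" if "i < n" for i using ws that by auto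
  \<comment> \<open>\<open>corthogonal\<close> gives orthogonal nonzero columns of arbitrary length;
    dividing by the norms makes them orthonormal.\<close>
  define W where "W = mat n n (\<lambda>(i,j). ws ! j $ i / complex_of_real (norm2_vec (ws ! j)))"
  have W: "W \<in> carrier_mat n n" by (simp add: W_def)
  have "mat_adjoint W * W = 1\<^sub>m n"
  proof (rule eq_matI)
    fix i j assume "i < dim_row (1\<^sub>m n :: complex mat)" "j < dim_col (1\<^sub>m n :: complex mat)"
    then have ij: "i < n" "j < n" by auto
    have "(mat_adjoint W * W) $$ (i,j) = (\<Sum>k<n. cnj (W $$ (k,i)) * W $$ (k,j))"
      using W ij by (simp add: scalar_prod_def atLeast0LessThan)
    also have "\<dots> = (\<Sum>k<n. ws ! j $ k * cnj (ws ! i $ k) / complex_of_real (norm2_vec (ws ! i) * norm2_vec (ws ! j)))"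
      using ij by (intro sum.cong) (auto simp: W_def)
    also have "\<dots> = (ws ! j \<bullet>c ws ! i) / complex_of_real (norm2_vec (ws ! i) * norm2_vec (ws ! j))"
      using wsc[OF ij(1)] by (simp add: cscalar_prod_sum sum_divide_distrib)
    also have "\<dots> = 1\<^sub>m n $$ (i,j)"
    proof (cases "i = j")
      case True
      have "ws ! j \<bullet>c ws ! j \<noteq> 0" using corthogonalD[OF ws(2), of j j] ij ws(3) by auto
      then have "complex_of_real ((norm2_vec (ws ! j))\<^sup>2) \<noteq> 0" by (simp only: norm2_vec_cscalar not_False_eq_True)
      then show ?thesis using True ij norm2_vec_cscalar[of "ws ! j"]
        by (auto simp: power2_eq_square)
    next
      case False
      then have "ws ! j \<bullet>c ws ! i = 0" using corthogonalD[OF ws(2), of j i] ij ws(3) by auto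
      then show ?thesis using False ij by simp
    qed
    finally show "(mat_adjoint W * W) $$ (i,j) = 1\<^sub>m n $$ (i,j)" .
  qed (use W in auto)
  moreover have "col W 0 = (1 / complex_of_real (norm2_vec v)) \<cdot>\<^sub>v v"
    using v n by (intro eq_vecI) (auto simp: W_def ws0)
  ultimately show ?thesis using W by blast
qed

lemma mat_adjoint_four_block:
  assumes "A \<in> carrier_mat nr1 nc1" "B \<in> carrier_mat nr1 nc2"
    "C \<in> carrier_mat nr2 nc1" "D \<in> carrier_mat nr2 nc2"
  shows "mat_adjoint (four_block_mat A B C D)
     = four_block_mat (mat_adjoint A) (mat_adjoint C) (mat_adjoint B) (mat_adjoint (D :: complex mat))"
  using assms by (intro eq_matI) auto

text \<open>Deflation: with an eigenvector as the first column of a unitary \<open>W\<close>, the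
  conjugated matrix has a multiple of a unit vector as first column and, being Hermitian, a first
  row that is zero beyond the diagonal. The induction runs on the remaining block. That the diagonal
  is real is left to \<open>nonneg_definite_sqrt\<close>.\<close>

theorem hermitian_unitarily_diagonalizable:
  fixes A :: "complex mat"
  assumes "A \<in> carrier_mat n n" "mat_adjoint A = A"
  shows "\<exists>U \<in> carrier_mat n n. \<exists>f. mat_adjoint U * U = 1\<^sub>m n \<and> A = U * mat_diag n f * mat_adjoint U"
  using assms
proof (induction n arbitrary: A)
  case 0
  then show ?case by (intro bexI[of _ "1\<^sub>m 0"] exI[of _ "\<lambda>_. 0"] conjI eq_matI) auto
next
  case (Suc n)
  note A = Suc.prems(1)
  from spectrum_non_empty[OF A] obtain e where "eigenvalue A e" by (auto simp: spectrum_def)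
  then obtain v where v: "v \<in> carrier_vec (Suc n)" and v0: "v \<noteq> 0\<^sub>v (Suc n)" and ev: "A *\<^sub>v v = e \<cdot>\<^sub>v v"
    using A by (auto simp: eigenvalue_def eigenvector_def)
  from unit_vector_extends_to_unitary[OF v v0] obtain W c where W: "W \<in> carrier_mat (Suc n) (Suc n)"
    and WW: "mat_adjoint W * W = 1\<^sub>m (Suc n)" and c: "col W 0 = c \<cdot>\<^sub>v v" by blast
  note W' = mat_adjoint_carrier[OF W]
  have WW': "W * mat_adjoint W = 1\<^sub>m (Suc n)" by (rule mat_mult_left_right_inverse[OF W' W WW])
  define A' where "A' = mat_adjoint W * A * W"
  have A': "A' \<in> carrier_mat (Suc n) (Suc n)" using W A by (auto simp: A'_def)
  have hA': "mat_adjoint A' = A'"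
  proof -
    have "mat_adjoint A' = mat_adjoint W * (mat_adjoint A * W)"
      unfolding A'_def using W A by (simp add: mat_adjoint_mult[of _ "Suc n" "Suc n" _ "Suc n"])
    then show ?thesis using W A by (simp add: A'_def Suc.prems(2) assoc_mult_mat[of _ "Suc n" "Suc n" _ "Suc n" _ "Suc n"])
  qed
  have "A *\<^sub>v col W 0 = e \<cdot>\<^sub>v col W 0"
    unfolding c using A v ev by (simp add: mult_mat_vec smult_smult_assoc mult.commute)
  moreover have "col A' 0 = mat_adjoint W *\<^sub>v (A *\<^sub>v col W 0)"
  proof -
    have "A' = mat_adjoint W * (A * W)" using A W by (simp add: A'_def assoc_mult_mat[of _ "Suc n" "Suc n" _ "Suc n" _ "Suc n"])
    then show ?thesis using A W col_mult2[of "mat_adjoint W" "Suc n" "Suc n" "A * W" "Suc n" 0]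
      col_mult2[of A "Suc n" "Suc n" W "Suc n" 0] by simp
  qed
  ultimately have "col A' 0 = e \<cdot>\<^sub>v (mat_adjoint W *\<^sub>v col W 0)"
    using mult_mat_vec[OF W', of "col W 0" e] W by (simp add: carrier_vecI)
  also have "mat_adjoint W *\<^sub>v col W 0 = col (mat_adjoint W * W) 0"
    using W by (simp add: col_mult2[of _ "Suc n" "Suc n" _ "Suc n"])
  also have "\<dots> = unit_vec (Suc n) 0" by (simp add: WW)
  finally have col0: "col A' 0 = e \<cdot>\<^sub>v unit_vec (Suc n) 0" .
  have A'0: "A' $$ (Suc i, 0) = 0" "A' $$ (0, Suc i) = 0" if "i < n" for i
  proof -
    have "A' $$ (Suc i, 0) = col A' 0 $ Suc i" using A' that by simp
    then show 1: "A' $$ (Suc i, 0) = 0" using that by (simp add: col0)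
    have "A' $$ (0, Suc i) = mat_adjoint A' $$ (0, Suc i)" by (simp only: hA')
    also have "\<dots> = cnj (A' $$ (Suc i, 0))" by (rule mat_adjoint_index) (use A' that in auto)
    finally show "A' $$ (0, Suc i) = 0" using 1 by simp
  qed
  define A4 where "A4 = mat n n (\<lambda>(i,j). A' $$ (Suc i, Suc j))"
  have A4: "A4 \<in> carrier_mat n n" by (simp add: A4_def)
  define E where "E = mat 1 1 (\<lambda>_. A' $$ (0,0))"
  have E: "E \<in> carrier_mat 1 1" by (simp add: E_def)
  have A'b: "A' = four_block_mat E (0\<^sub>m 1 n) (0\<^sub>m n 1) A4"
    using A' A'0 by (intro eq_matI) (auto simp: E_def A4_def gr0_conv_Suc)
  have "mat_adjoint A4 = A4"
  proof (rule eq_matI)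
    fix i j assume ij: "i < dim_row A4" "j < dim_col A4"
    have "mat_adjoint A' $$ (Suc i, Suc j) = cnj (A' $$ (Suc j, Suc i))"
      by (rule mat_adjoint_index) (use A' A4 ij in auto)
    then show "mat_adjoint A4 $$ (i,j) = A4 $$ (i,j)" using ij A4 by (simp add: hA') (simp add: A4_def)
  qed (use A4 in auto)
  from Suc.IH[OF A4 this] obtain U4 g where U4: "U4 \<in> carrier_mat n n"
    and UU4: "mat_adjoint U4 * U4 = 1\<^sub>m n" and A4d: "A4 = U4 * mat_diag n g * mat_adjoint U4" by blast
  define V where "V = four_block_mat (1\<^sub>m 1) (0\<^sub>m 1 n) (0\<^sub>m n 1) U4"
  have V: "V \<in> carrier_mat (Suc n) (Suc n)" using U4 four_block_carrier_mat[of "1\<^sub>m 1" 1 1 U4 n n] by (simp add: V_def)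
  have zero: "mat_adjoint (0\<^sub>m a b) = (0\<^sub>m b a :: complex mat)" for a b by (rule eq_matI) auto
  have V': "mat_adjoint V = four_block_mat (1\<^sub>m 1) (0\<^sub>m 1 n) (0\<^sub>m n 1) (mat_adjoint U4)"
    unfolding V_def using mat_adjoint_four_block[of "1\<^sub>m 1" 1 1 "0\<^sub>m 1 n" n "0\<^sub>m n 1" n U4] U4 by (simp add: zero)
  define f where "f = (\<lambda>i. case i of 0 \<Rightarrow> A' $$ (0,0) | Suc i \<Rightarrow> g i)"
  have Df: "mat_diag (Suc n) f = four_block_mat E (0\<^sub>m 1 n) (0\<^sub>m n 1) (mat_diag n g)"
    by (rule eq_matI) (auto simp: mat_diag_def E_def f_def split: nat.split)
  have VV: "mat_adjoint V * V = 1\<^sub>m (Suc n)"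
    unfolding V' unfolding V_def
    by (subst mult_four_block_mat[of _ 1 1 _ n _ n _ _ 1 _ n]) (use U4 UU4 in auto)
  have "V * mat_diag (Suc n) f = four_block_mat E (0\<^sub>m 1 n) (0\<^sub>m n 1) (U4 * mat_diag n g)"
    unfolding V_def Df
    by (subst mult_four_block_mat[of _ 1 1 _ n _ n _ _ 1 _ n])
       (use U4 E in \<open>auto simp: left_mult_zero_mat[of _ n n] right_mult_zero_mat[of _ n n] left_add_zero_mat[of _ "Suc 0" n] left_add_zero_mat[of _ n "Suc 0"]\<close>)
  then have "V * mat_diag (Suc n) f * mat_adjoint V = A'"
    unfolding V' A'b A4d
    by (simp only:, subst mult_four_block_mat[of _ 1 1 _ n _ n _ _ 1 _ n])
       (use U4 E in \<open>auto simp: left_mult_zero_mat[of _ n n] right_mult_zero_mat[of _ n n] left_add_zero_mat[of _ "Suc 0" n] left_add_zero_mat[of _ n "Suc 0"]\<close>)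
  then have A'd: "A' = V * mat_diag (Suc n) f * mat_adjoint V" ..
  define U where "U = W * V"
  have U: "U \<in> carrier_mat (Suc n) (Suc n)" using W V by (simp add: U_def)
  note assoc = assoc_mult_mat[of _ "Suc n" "Suc n" _ "Suc n" _ "Suc n"]
  have U': "mat_adjoint U = mat_adjoint V * mat_adjoint W"
    unfolding U_def by (rule mat_adjoint_mult[OF W V])
  have "mat_adjoint U * U = mat_adjoint V * ((mat_adjoint W * W) * V)"
    unfolding U' using W V by (simp add: U_def assoc)
  then have "mat_adjoint U * U = 1\<^sub>m (Suc n)" using V by (simp add: WW VV)
  moreover have "A = U * mat_diag (Suc n) f * mat_adjoint U"
  proof -
    have "A = (W * mat_adjoint W) * A * (W * mat_adjoint W)" using A by (simp add: WW')
    also have "\<dots> = W * A' * mat_adjoint W" using A W by (simp add: A'_def assoc)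
    also have "\<dots> = U * mat_diag (Suc n) f * mat_adjoint U"
      unfolding A'd U' using W V by (simp add: U_def assoc)
    finally show ?thesis .
  qed
  ultimately show ?case using U by blast
qed

section \<open>Square roots of Hermitian nonnegative definite matrices\<close>

lemma mult_mat_vec_zero: "A \<in> carrier_mat n m \<Longrightarrow> A *\<^sub>v 0\<^sub>v m = 0\<^sub>v n"
  for A :: "complex mat"
  by (rule eq_vecI) auto

lemma norm2_mult_hermitian_square:
  assumes "R \<in> carrier_mat n n" "mat_adjoint R = R" "v \<in> carrier_vec n"
  shows "quad_form (R * R) v = (norm2_vec (R *\<^sub>v v))\<^sup>2"
  using quad_form_adjoint_mult[OF assms(1,3)] assms(2) by simp

lemma nonneg_definite_square:
  assumes "R \<in> carrier_mat n n" "mat_adjoint R = R"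
  shows "nonneg_definite (R * R)"
  using assms norm2_mult_hermitian_square[OF assms] mat_adjoint_mult[OF assms(1) assms(1)]
  by (auto simp: nonneg_definite_def hermitian_def)

lemma nonneg_definite_sqrt:
  assumes A: "A \<in> carrier_mat n n" and nn: "nonneg_definite A"
  shows "\<exists>R \<in> carrier_mat n n. nonneg_definite R \<and> R * R = A"
proof -
  have hA: "mat_adjoint A = A" using nn by (simp add: nonneg_definite_def hermitian_def)
  from hermitian_unitarily_diagonalizable[OF A hA] obtain U f where U: "U \<in> carrier_mat n n"
    and UU: "mat_adjoint U * U = 1\<^sub>m n" and Af: "A = U * mat_diag n f * mat_adjoint U" by blast
  note assoc = assoc_mult_mat[of _ n n _ n _ n]
  \<comment> \<open>Functional calculus in the eigenbasis of \<open>A\<close>: products of functions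
    become products of matrices, so the square root can be taken eigenvalue by eigenvalue.\<close>
  define M where "M h = U * mat_diag n (\<lambda>i. complex_of_real (h i)) * mat_adjoint U" for h
  have M: "M h \<in> carrier_mat n n" for h using U by (auto simp: M_def)
  have MM: "M h * M k = M (\<lambda>i. h i * k i)" for h k
  proof -
    let ?H = "mat_diag n (\<lambda>i. complex_of_real (h i))" and ?K = "mat_diag n (\<lambda>i. complex_of_real (k i))"
    have HK: "?H \<in> carrier_mat n n" "?K \<in> carrier_mat n n" by simp_all
    note c = HK U mat_adjoint_carrier[OF U] mult_carrier_mat[of _ n n _ n]
    have "M h * M k = U * ?H * ((mat_adjoint U * U) * (?K * mat_adjoint U))"
      by (simp only: M_def assoc c)
    also have "\<dots> = U * (?H * ?K) * mat_adjoint U"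
      by (simp only: UU left_mult_one_mat[of _ n n] assoc c)
    finally show ?thesis by (simp add: M_def)
  qed
  have Mh: "mat_adjoint (M h) = M h" for h
  proof -
    have "mat_adjoint (M h) = U * (mat_adjoint (mat_diag n (\<lambda>i. complex_of_real (h i))) * mat_adjoint U)"
      unfolding M_def using U by (simp add: mat_adjoint_mult[of _ n n _ n])
    then show ?thesis using U by (simp add: M_def mat_adjoint_mat_diag assoc)
  qed
  \<comment> \<open>Column i of \<open>U\<close> is a unit eigenvector, so the quadratic form of
    \<open>A\<close> at it is the eigenvalue; this makes the eigenvalue real and
    nonnegative.\<close>
  have fi: "f i = complex_of_real (quad_form A (col U i))" "quad_form A (col U i) \<ge> 0" if i: "i < n" for i
  proof -
    have ci: "col U i \<in> carrier_vec n" using U i by auto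
    have "mat_adjoint U * A * U = (mat_adjoint U * U) * mat_diag n f * (mat_adjoint U * U)"
      using U by (simp add: Af assoc)
    then have D: "mat_adjoint U * A * U = mat_diag n f" by (simp add: UU right_mult_one_mat[of _ n n] left_mult_one_mat[of _ n n])
    have "(A *\<^sub>v col U i) \<bullet>c col U i = (mat_adjoint U * (A * U)) $$ (i,i)"
      using U A i by (simp add: cscalar_prod_sum scalar_prod_def atLeast0LessThan mult.commute)
    also have "\<dots> = mat_diag n f $$ (i,i)" using U A by (simp add: D[symmetric] assoc)
    also have "\<dots> = f i" using i by (simp add: mat_diag_def)
    finally have 1: "(A *\<^sub>v col U i) \<bullet>c col U i = f i" .
    have "cnj (f i) = f i"
    proof -
      have "(A *\<^sub>v col U i) \<bullet>c col U i = col U i \<bullet>c (A *\<^sub>v col U i)"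
        using cscalar_prod_adjoint[OF A ci ci] hA by simp
      also have "\<dots> = cnj ((A *\<^sub>v col U i) \<bullet>c col U i)"
        by (rule cscalar_prod_commute) (use A U in auto)
      finally show ?thesis using 1 by simp
    qed
    then show "f i = complex_of_real (quad_form A (col U i))"
      using 1 by (simp add: quad_form_def complex_eq_iff)
    show "quad_form A (col U i) \<ge> 0" using nn ci A by (auto simp: nonneg_definite_def)
  qed
  \<comment> \<open>The value 0 beyond n makes \<open>g\<close> nonnegative at every index, so that
    the square roots simplify without a side condition.\<close>
  define g where "g i = (if i < n then quad_form A (col U i) else 0)" for i
  have g0: "g i \<ge> 0" for i using fi(2) by (simp add: g_def)
  have "mat_diag n f = mat_diag n (\<lambda>i. complex_of_real (g i))"
    by (rule eq_matI) (auto simp: mat_diag_def g_def fi)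
  then have Ag: "A = M g" using Af by (simp add: M_def)
  \<comment> \<open>Fourth roots exhibit the candidate as the square of a Hermitian matrix, hence as
    nonnegative definite.\<close>
  have "M (\<lambda>i. sqrt (sqrt (g i))) * M (\<lambda>i. sqrt (sqrt (g i))) = M (\<lambda>i. sqrt (g i))"
    using g0 by (simp add: MM)
  then have "nonneg_definite (M (\<lambda>i. sqrt (g i)))" using nonneg_definite_square[OF M Mh] by metis
  moreover have "M (\<lambda>i. sqrt (g i)) * M (\<lambda>i. sqrt (g i)) = A" using g0 by (simp add: MM Ag)
  ultimately show ?thesis using M by blast
qed

text \<open>Writing A = R R with R Hermitian turns the quadratic form into |R v|^2, so R v and then
  A v vanish.\<close>

lemma nonneg_definite_quad_form_eq_0:
  assumes A: "A \<in> carrier_mat n n" and nn: "nonneg_definite A" and v: "v \<in> carrier_vec n" and q: "quad_form A v = 0"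
  shows "A *\<^sub>v v = 0\<^sub>v n"
proof -
  from nonneg_definite_sqrt[OF A nn] obtain R where R: "R \<in> carrier_mat n n" "nonneg_definite R" "R * R = A" by blast
  then have h: "mat_adjoint R = R" by (simp add: nonneg_definite_def hermitian_def)
  have "(norm2_vec (R *\<^sub>v v))\<^sup>2 = 0" using norm2_mult_hermitian_square[OF R(1) h v] R q by simp
  then have "R *\<^sub>v v = 0\<^sub>v n" using R v norm2_vec_eq_0[of "R *\<^sub>v v" n] by auto
  then have "R *\<^sub>v (R *\<^sub>v v) = 0\<^sub>v n" using R(1) by (simp add: mult_mat_vec_zero[OF R(1)])
  then show ?thesis using assoc_mult_mat_vec[OF R(1) R(1) v] R(3) by simp
qed

lemma pos_definite_iff:
  assumes "A \<in> carrier_mat n n"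
  shows "pos_definite A \<longleftrightarrow> nonneg_definite A \<and> (\<forall>v \<in> carrier_vec n. A *\<^sub>v v = 0\<^sub>v n \<longrightarrow> v = 0\<^sub>v n)"
proof
  assume pd: "pos_definite A"
  have "nonneg_definite A" unfolding nonneg_definite_def
  proof (intro conjI ballI)
    fix v :: "complex vec" assume v: "v \<in> carrier_vec (dim_row A)"
    show "0 \<le> quad_form A v"
    proof (cases "v = 0\<^sub>v (dim_row A)")
      case True then show ?thesis using assms by (simp add: quad_form_def)
    qed (use pd v in \<open>force simp: pos_definite_def\<close>)
  qed (use pd in \<open>simp add: pos_definite_def\<close>)
  moreover have "v = 0\<^sub>v n" if "v \<in> carrier_vec n" "A *\<^sub>v v = 0\<^sub>v n" for v :: "complex vec"
  proof (rule ccontr)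
    assume "v \<noteq> 0\<^sub>v n"
    then have "quad_form A v > 0" using pd that assms by (auto simp: pos_definite_def)
    then show False using that by (simp add: quad_form_def)
  qed
  ultimately show "nonneg_definite A \<and> (\<forall>v \<in> carrier_vec n. A *\<^sub>v v = 0\<^sub>v n \<longrightarrow> v = 0\<^sub>v n)" by blast
next
  assume r: "nonneg_definite A \<and> (\<forall>v \<in> carrier_vec n. A *\<^sub>v v = 0\<^sub>v n \<longrightarrow> v = 0\<^sub>v n)"
  then have "quad_form A v > 0" if "v \<in> carrier_vec n" "v \<noteq> 0\<^sub>v n" for v
    using that nonneg_definite_quad_form_eq_0[OF assms _ that(1)] assms
    by (metis carrier_matD(1) less_eq_real_def nonneg_definite_def)
  then show "pos_definite A" using r assms by (auto simp: pos_definite_def nonneg_definite_def)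
qed

lemma pos_definite_det:
  assumes "A \<in> carrier_mat n n" "pos_definite A"
  shows "det A \<noteq> 0"
  using assms pos_definite_iff[OF assms(1)] det_0_iff_vec_prod_zero_field[OF assms(1)] by auto

lemma pos_definite_sqrt_unique:
  assumes S: "S \<in> carrier_mat n n" "pos_definite S" and R: "R \<in> carrier_mat n n" "pos_definite R"
    and eq: "S * S = R * R"
  shows "S = R"
proof -
  have hS: "mat_adjoint S = S" and hR: "mat_adjoint R = R"
    using S R by (auto simp: pos_definite_def hermitian_def)
  \<comment> \<open>if $N v = \lambda v$, pairing $S N + N R = S^2 - R^2 = 0$ with \<open>v\<close> gives $\lambda\, v^H (S + R) v = 0$\<close>
  define N where "N = S - R"
  have N: "N \<in> carrier_mat n n" using S R by (auto simp: N_def)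
  have hN: "mat_adjoint N = N" unfolding N_def using mat_adjoint_minus[OF S(1) R(1)] hS hR by simp
  from hermitian_unitarily_diagonalizable[OF N hN] obtain U f where U: "U \<in> carrier_mat n n"
    and UU: "mat_adjoint U * U = 1\<^sub>m n" and Nf: "N = U * mat_diag n f * mat_adjoint U" by blast
  have NU: "N * U = U * mat_diag n f"
  proof -
    have "N * U = U * mat_diag n f * (mat_adjoint U * U)"
      using U by (simp add: Nf assoc_mult_mat[of _ n n _ n _ n])
    then show ?thesis using U by (simp add: UU right_mult_one_mat[of _ n n])
  qed
  have UU': "U * mat_adjoint U = 1\<^sub>m n" by (rule mat_mult_left_right_inverse[OF _ U UU]) (use U in auto)
  have f0: "f i = 0" if i: "i < n" for i
  proof -
    define v where "v = col U i"
    have v: "v \<in> carrier_vec n" using U i by (auto simp: v_def)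
    have v0: "v \<noteq> 0\<^sub>v n"
    proof
      assume v0: "v = 0\<^sub>v n"
      have "(mat_adjoint U * U) $$ (i,i) = row (mat_adjoint U) i \<bullet> v" using U i by (simp add: v_def)
      also have "\<dots> = 0" using U i v0 by simp
      finally show False using UU i by simp
    qed
    have Nv: "N *\<^sub>v v = f i \<cdot>\<^sub>v v"
    proof -
      have "N *\<^sub>v v = col (N * U) i" using col_mult2[OF N U i] by (simp add: v_def)
      also have "\<dots> = f i \<cdot>\<^sub>v v" unfolding NU using U i
        by (intro eq_vecI) (auto simp: mat_diag_mult_right[OF U] v_def)
      finally show ?thesis .
    qed
    have "S * N + N * R = 0\<^sub>m n n"
    proof -
      have "S * N + N * R = (S * S - S * R) + (S * R - R * R)"
        unfolding N_def using S R by (simp add: mult_minus_distrib_mat[of _ n n] minus_mult_distrib_mat[of _ n n])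
      then show ?thesis unfolding eq using S R by (intro eq_matI) auto
    qed
    then have "0\<^sub>v n = (S * N + N * R) *\<^sub>v v" using v by (intro eq_vecI) auto
    also have "\<dots> = S *\<^sub>v (N *\<^sub>v v) + N *\<^sub>v (R *\<^sub>v v)"
      using S R N v by (simp add: add_mult_distrib_mat_vec[of _ n n] assoc_mult_mat_vec[of _ n n])
    finally have z: "S *\<^sub>v (N *\<^sub>v v) + N *\<^sub>v (R *\<^sub>v v) = 0\<^sub>v n" by simp
    \<comment> \<open>Realness of the eigenvalue is used when \<open>N\<close> is moved to the
      second argument of the inner product, where its eigenvalue comes out conjugated.\<close>
    have "cnj (f i) = f i"
    proof -
      have "f i * (v \<bullet>c v) = (N *\<^sub>v v) \<bullet>c v" using v by (simp add: Nv)
      also have "\<dots> = v \<bullet>c (N *\<^sub>v v)" using cscalar_prod_adjoint[OF N v v] hN by simp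
      also have "\<dots> = cnj (f i) * (v \<bullet>c v)" using v by (simp add: Nv conjugate_smult_vec)
      finally show ?thesis using v v0 by (simp add: conjugate_square_eq_0_vec)
    qed
    have "0 = (S *\<^sub>v (N *\<^sub>v v) + N *\<^sub>v (R *\<^sub>v v)) \<bullet>c v" unfolding z using v by simp
    also have "\<dots> = (S *\<^sub>v (N *\<^sub>v v)) \<bullet>c v + (N *\<^sub>v (R *\<^sub>v v)) \<bullet>c v"
      by (rule cscalar_prod_add_left) (use S N R v in auto)
    also have "(N *\<^sub>v (R *\<^sub>v v)) \<bullet>c v = (R *\<^sub>v v) \<bullet>c (N *\<^sub>v v)"
      using cscalar_prod_adjoint[OF N _ v, of "R *\<^sub>v v"] hN R v by simp
    also have "(S *\<^sub>v (N *\<^sub>v v)) \<bullet>c v + (R *\<^sub>v v) \<bullet>c (N *\<^sub>v v)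
        = f i * ((S *\<^sub>v v) \<bullet>c v + (R *\<^sub>v v) \<bullet>c v)"
      using S R v \<open>cnj (f i) = f i\<close> by (simp add: Nv mult_mat_vec[of _ n n] conjugate_smult_vec algebra_simps)
    finally have *: "f i * ((S *\<^sub>v v) \<bullet>c v + (R *\<^sub>v v) \<bullet>c v) = 0" by simp
    have "quad_form S v > 0" "quad_form R v > 0" using S R v v0 by (auto simp: pos_definite_def)
    then have "Re ((S *\<^sub>v v) \<bullet>c v + (R *\<^sub>v v) \<bullet>c v) > 0" by (simp add: quad_form_def)
    then have "(S *\<^sub>v v) \<bullet>c v + (R *\<^sub>v v) \<bullet>c v \<noteq> 0" by (metis less_irrefl zero_complex.simps(1))
    with * show ?thesis by simp
  qed
  have "mat_diag n f = 0\<^sub>m n n" by (rule eq_matI) (auto simp: mat_diag_def f0)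
  then have "N = 0\<^sub>m n n" using Nf U by simp
  show ?thesis
  proof (rule eq_matI)
    fix i j assume ij: "i < dim_row R" "j < dim_col R"
    have "N $$ (i,j) = 0" using \<open>N = 0\<^sub>m n n\<close> ij R by simp
    then show "S $$ (i,j) = R $$ (i,j)" using ij R S by (simp add: N_def)
  qed (use S R in auto)
qed

lemma pd_sqrt_properties:
  assumes A: "A \<in> carrier_mat n n" and pd: "pos_definite A"
  shows "pd_sqrt A \<in> carrier_mat n n" "pos_definite (pd_sqrt A)" "pd_sqrt A * pd_sqrt A = A"
proof -
  from pd pos_definite_iff[OF A] have nn: "nonneg_definite A" by blast
  from nonneg_definite_sqrt[OF A nn] obtain R where R: "R \<in> carrier_mat n n" "nonneg_definite R" "R * R = A" by blast
  have "v = 0\<^sub>v n" if "v \<in> carrier_vec n" "R *\<^sub>v v = 0\<^sub>v n" for v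
  proof -
    have "A *\<^sub>v v = R *\<^sub>v (R *\<^sub>v v)" using assoc_mult_mat_vec[OF R(1) R(1) that(1)] R(3) by simp
    also have "\<dots> = 0\<^sub>v n" using that mult_mat_vec_zero[OF R(1)] by simp
    finally show ?thesis using that pd pos_definite_iff[OF A] by blast
  qed
  then have pR: "pos_definite R" using R pos_definite_iff[OF R(1)] by blast
  \<comment> \<open>The description in \<open>pd_sqrt\<close> ranges over matrices of all sizes; S *
    S = A fixes both dimensions of S, so that uniqueness among n x n matrices applies.\<close>
  have carr: "S \<in> carrier_mat n n" if "pos_definite S" "S * S = A" for S
  proof -
    have "dim_row S = n" using that A by (metis carrier_matD(1) index_mult_mat(2))
    moreover have "dim_col S = n" using that A by (metis carrier_matD(2) index_mult_mat(3))
    ultimately show ?thesis by auto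
  qed
  have "pos_definite (pd_sqrt A) \<and> pd_sqrt A * pd_sqrt A = A"
    unfolding pd_sqrt_def
  proof (rule theI[of _ R])
    show "pos_definite R \<and> R * R = A" using pR R by blast
    fix S assume "pos_definite S \<and> S * S = A"
    then show "S = R" using pos_definite_sqrt_unique[OF carr _ R(1) pR] R by auto
  qed
  then show "pd_sqrt A \<in> carrier_mat n n" "pos_definite (pd_sqrt A)" "pd_sqrt A * pd_sqrt A = A"
    using carr by auto
qed

lemma inv_sqrt_properties:
  assumes A: "A \<in> carrier_mat n n" and pd: "pos_definite A"
  shows "inv_sqrt A \<in> carrier_mat n n" "pd_sqrt A * inv_sqrt A = 1\<^sub>m n"
proof -
  note S = pd_sqrt_properties[OF A pd]
  have "pd_sqrt A \<in> Units (ring_mat TYPE(complex) n ())"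
    using det_non_zero_imp_unit[OF S(1) pos_definite_det[OF S(1,2)]] .
  then obtain B where "mat_inverse (pd_sqrt A) = Some B"
    using mat_inverse(1)[OF S(1), of "()"] by (cases "mat_inverse (pd_sqrt A)") auto
  then show "inv_sqrt A \<in> carrier_mat n n" "pd_sqrt A * inv_sqrt A = 1\<^sub>m n"
    using mat_inverse(2)[OF S(1)] by (auto simp: inv_sqrt_def)
qed

text \<open>With S = A^(1/2) and B = S^(-1) Q^H one has S B = Q^H, hence Q = B^H S: the bounded
  matrix is exactly the factor between S v and Q v, and |S v|^2 is the quadratic form. Hypothesis
  (i) enters through this factorisation.\<close>

lemma norm2_mult_le_quad_form:
  assumes A: "A \<in> carrier_mat n n" and pd: "pos_definite A" and Q: "Q \<in> carrier_mat n n" and v: "v \<in> carrier_vec n"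
    and c: "\<And>i j. i < n \<Longrightarrow> j < n \<Longrightarrow> cmod ((inv_sqrt A * mat_adjoint Q) $$ (i,j)) \<le> c"
  shows "(norm2_vec (Q *\<^sub>v v))\<^sup>2 \<le> real n * real n * c\<^sup>2 * quad_form A v"
proof -
  define S where "S = pd_sqrt A"
  define B where "B = inv_sqrt A * mat_adjoint Q"
  note S = pd_sqrt_properties[OF A pd, folded S_def] and I = inv_sqrt_properties[OF A pd, folded S_def]
  have hS: "mat_adjoint S = S" using S by (simp add: pos_definite_def hermitian_def)
  have B: "B \<in> carrier_mat n n" using I Q by (auto simp: B_def)
  have "S * B = mat_adjoint Q" using S I Q assoc_mult_mat[of S n n "inv_sqrt A" n "mat_adjoint Q" n]
    by (simp add: B_def)
  then have "mat_adjoint B * S = Q" using mat_adjoint_mult[OF S(1) B] hS by simp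
  then have "Q *\<^sub>v v = mat_adjoint B *\<^sub>v (S *\<^sub>v v)"
    using assoc_mult_mat_vec[of "mat_adjoint B" n n S n v] B S v by auto
  also have "(norm2_vec \<dots>)\<^sup>2 \<le> real n * real n * c\<^sup>2 * (norm2_vec (S *\<^sub>v v))\<^sup>2"
    by (rule norm2_mult_mat_vec_le) (use B S v c in \<open>auto simp: B_def[symmetric]\<close>)
  finally show ?thesis using norm2_mult_hermitian_square[OF S(1) hS v] S(3) by simp
qed

text \<open>The vector \<open>unit_vec m j\<close> has 1-norm 1 and picks out column j.\<close>

lemma cmod_le_norm1_mat:
  assumes A: "A \<in> carrier_mat n m" and ij: "i < n" "j < m"
  shows "cmod (A $$ (i,j)) \<le> norm1_mat A"
proof -
  let ?V = "{v \<in> carrier_vec (dim_col A). norm1_vec v = 1}"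
  \<comment> \<open>The sum of all moduli bounds the set; without an upper bound the supremum of
    real numbers would carry no information.\<close>
  have "norm1_vec (A *\<^sub>v v) \<le> (\<Sum>i<n. \<Sum>j<m. cmod (A $$ (i,j)))" if v: "v \<in> ?V" for v
  proof -
    have 1: "cmod (v $ j) \<le> 1" if "j < m" for j
    proof -
      have "cmod (v $ j) \<le> (\<Sum>j<m. cmod (v $ j))" using that by (intro member_le_sum) auto
      then show ?thesis using v A by (auto simp: norm1_vec_def)
    qed
    have "norm1_vec (A *\<^sub>v v) = (\<Sum>i<n. cmod (\<Sum>j<m. A $$ (i,j) * v $ j))"
      using A v by (auto simp: norm1_vec_def scalar_prod_def atLeast0LessThan intro!: sum.cong arg_cong[of _ _ cmod])
    also have "\<dots> \<le> (\<Sum>i<n. \<Sum>j<m. cmod (A $$ (i,j)))"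
    proof (intro sum_mono order_trans[OF norm_sum])
      fix i j assume "j \<in> {..<m}"
      then show "cmod (A $$ (i,j) * v $ j) \<le> cmod (A $$ (i,j))"
        using mult_left_mono[OF 1[of j], of "cmod (A $$ (i,j))"] by (simp add: norm_mult)
    qed
    finally show ?thesis .
  qed
  then have bdd: "bdd_above ((\<lambda>v. norm1_vec (A *\<^sub>v v)) ` ?V)" by (intro bdd_aboveI2) blast
  have e: "unit_vec m j \<in> ?V"
    using A ij by (auto simp: norm1_vec_def unit_vec_def if_distrib[of cmod] sum.If_cases cong: if_cong)
  have "cmod (A $$ (i,j)) = cmod ((A *\<^sub>v unit_vec m j) $ i)" using A ij by simp
  also have "\<dots> \<le> norm1_vec (A *\<^sub>v unit_vec m j)"
    unfolding norm1_vec_def using A ij by (intro member_le_sum[of i]) auto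
  also have "\<dots> \<le> norm1_mat A" unfolding norm1_mat_def by (rule cSUP_upper[OF e bdd])
  finally show ?thesis .
qed

section \<open>Commuting pairs of matrices\<close>

text \<open>
  The witness \<open>E\<close> is the projection onto the kernel of \<open>P\<close> along its range, which commutes with \<open>Q\<close>.
  An invertible \<open>P + Q * E\<close> shows that \<open>P\<close> and \<open>Q\<close> have no common left kernel either.
\<close>
lemma commuting_diagonalizable_pencil:
  assumes P: "P \<in> carrier_mat n n" and Q: "Q \<in> carrier_mat n n" and PQ: "P * Q = Q * P"
    and d: "diagonalizable P"
    and ker: "\<And>v. v \<in> carrier_vec n \<Longrightarrow> P *\<^sub>v v = 0\<^sub>v n \<Longrightarrow> Q *\<^sub>v v = 0\<^sub>v n \<Longrightarrow> v = 0\<^sub>v n"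
  shows "\<exists>E \<in> carrier_mat n n. det (P + Q * E) \<noteq> 0"
proof -
  from d obtain D V W where D: "diagonal_mat D" and w: "similar_mat_wit P D V W"
    unfolding diagonalizable_def similar_mat_def by blast
  note w = similar_mat_witD2[OF P w]
  note c = w(5,6,7) P Q
  note assoc = assoc_mult_mat[of _ n n _ n _ n]
  have PV: "P * V = V * D"
  proof -
    have "P * V = V * D * (W * V)" unfolding w(3) using c by (simp add: assoc)
    then show ?thesis using c by (simp add: w(2) right_mult_one_mat[of _ n n])
  qed
  have WP: "W * P = D * W"
  proof -
    have "W * P = (W * V) * (D * W)" unfolding w(3) using c by (simp add: assoc)
    then show ?thesis using c by (simp add: w(2) left_mult_one_mat[of _ n n])
  qed
  \<comment> \<open>Indicator of the zero eigenvalues of \<open>P\<close> in its eigenbasis;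
    \<open>E\<close> is \<open>Z\<close> carried back to the original basis.\<close>
  define Z where "Z = mat_diag n (\<lambda>i. if D $$ (i,i) = 0 then 1 else 0 :: complex)"
  define Q' where "Q' = W * Q * V"
  define E where "E = V * Z * W"
  have Z: "Z \<in> carrier_mat n n" by (simp add: Z_def)
  have c: "V \<in> carrier_mat n n" "W \<in> carrier_mat n n" "D \<in> carrier_mat n n" "Q' \<in> carrier_mat n n" "E \<in> carrier_mat n n"
    using c Z by (auto simp: Q'_def E_def)
  have Dd: "D = mat_diag n (\<lambda>i. D $$ (i,i))"
    using D c by (intro eq_matI) (auto simp: mat_diag_def diagonal_mat_def)
  have "D * Q' = Q' * D"
  proof -
    have "D * Q' = (D * W) * (Q * V)" using c P Q by (simp add: Q'_def assoc)
    also have "\<dots> = W * (P * Q) * V" unfolding WP[symmetric] using c P Q by (simp add: assoc)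
    also have "\<dots> = Q' * D" unfolding PQ using c P Q by (simp add: Q'_def assoc PV)
    finally show ?thesis .
  qed
  \<comment> \<open>Commuting with the diagonal \<open>D\<close> forces \<open>Q'\<close> to vanish
    between different eigenvalues, so it commutes with functions of \<open>D\<close> such as
    \<open>Z\<close>.\<close>
  then have "(D $$ (i,i) - D $$ (j,j)) * Q' $$ (i,j) = 0" if "i < n" "j < n" for i j
  proof -
    have "(D * Q') $$ (i,j) = D $$ (i,i) * Q' $$ (i,j)"
      by (subst Dd) (use c that in \<open>simp add: mat_diag_mult_left[of _ n n]\<close>)
    moreover have "(Q' * D) $$ (i,j) = Q' $$ (i,j) * D $$ (j,j)"
      by (subst Dd) (use c that in \<open>simp add: mat_diag_mult_right[of _ n n]\<close>)
    ultimately show ?thesis using \<open>D * Q' = Q' * D\<close> by (auto simp: algebra_simps)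
  qed
  then have "Z * Q' = Q' * Z"
    unfolding Z_def mat_diag_mult_left[OF c(4)] mat_diag_mult_right[OF c(4)]
    by (intro eq_matI) (auto split: if_splits, (metis mult_eq_0_iff eq_iff_diff_eq_0)+)
  have ZD: "Z * D = 0\<^sub>m n n"
    by (subst Dd, unfold Z_def mat_diag_diag) (auto simp: mat_diag_def intro!: eq_matI)
  have ZZ: "Z * Z = Z" unfolding Z_def mat_diag_diag by (rule arg_cong[of _ _ "mat_diag n"]) auto
  have "det (P + Q * E) \<noteq> 0"
  proof
    assume "det (P + Q * E) = 0"
    then obtain v where v: "v \<in> carrier_vec n" "v \<noteq> 0\<^sub>v n" "(P + Q * E) *\<^sub>v v = 0\<^sub>v n"
      using det_0_iff_vec_prod_zero_field[of "P + Q * E" n] c P Q by auto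
    define u where "u = W *\<^sub>v v"
    have u: "u \<in> carrier_vec n" using c v by (auto simp: u_def)
    have "D *\<^sub>v u + Q' *\<^sub>v (Z *\<^sub>v u) = W *\<^sub>v ((P + Q * E) *\<^sub>v v)"
    proof -
      have "W * (P + Q * E) = (D + Q' * Z) * W"
        using c P Q Z by (simp add: mult_add_distrib_mat[of _ n n] add_mult_distrib_mat[of _ n n] WP Q'_def E_def assoc)
      then have "W *\<^sub>v ((P + Q * E) *\<^sub>v v) = ((D + Q' * Z) * W) *\<^sub>v v"
        using c P Q v(1) by (simp add: assoc_mult_mat_vec[of _ n n _ n, symmetric])
      also have "\<dots> = (D + Q' * Z) *\<^sub>v u" using c Z v by (simp add: u_def assoc_mult_mat_vec[of _ n n _ n])
      also have "\<dots> = D *\<^sub>v u + Q' *\<^sub>v (Z *\<^sub>v u)"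
        using c Z u by (simp add: add_mult_distrib_mat_vec[of _ n n] assoc_mult_mat_vec[of _ n n _ n])
      finally show ?thesis ..
    qed
    then have *: "D *\<^sub>v u + Q' *\<^sub>v (Z *\<^sub>v u) = 0\<^sub>v n" using v c by (simp add: mult_mat_vec_zero)
    have zv: "0\<^sub>m n n *\<^sub>v x = 0\<^sub>v n" if "x \<in> carrier_vec n" for x :: "complex vec"
      using that by (intro eq_vecI) auto
    define y where "y = Z *\<^sub>v u"
    have y: "y \<in> carrier_vec n" using Z u by (auto simp: y_def)
    have Zy: "Z *\<^sub>v y = y" unfolding y_def using Z u by (simp add: assoc_mult_mat_vec[of _ n n _ n, symmetric] ZZ)
    have QZ: "Z *\<^sub>v (Q' *\<^sub>v y) = Q' *\<^sub>v y"
    proof -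
      have "Z *\<^sub>v (Q' *\<^sub>v y) = (Z * Q') *\<^sub>v y" using Z c y by (simp add: assoc_mult_mat_vec[of _ n n _ n])
      also have "\<dots> = Q' *\<^sub>v (Z *\<^sub>v y)" using Z c y by (simp add: \<open>Z * Q' = Q' * Z\<close> assoc_mult_mat_vec[of _ n n _ n])
      finally show ?thesis by (simp add: Zy)
    qed
    have ZDu: "Z *\<^sub>v (D *\<^sub>v u) = 0\<^sub>v n"
      using Z c u zv[OF u] by (simp add: assoc_mult_mat_vec[of _ n n _ n, symmetric] ZD)
    \<comment> \<open>\<open>Z\<close> annihilates \<open>D *\<^sub>v u\<close> and fixes
      \<open>Q' *\<^sub>v y\<close>, so applying it separates the two terms of a vanishing sum: both
      are zero.\<close>
    have "Z *\<^sub>v (D *\<^sub>v u + Q' *\<^sub>v y) = Z *\<^sub>v (D *\<^sub>v u) + Z *\<^sub>v (Q' *\<^sub>v y)"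
      by (rule mult_add_distrib_mat_vec) (use Z c u y in auto)
    then have Qy: "Q' *\<^sub>v y = 0\<^sub>v n" using * Z c y by (simp add: y_def[symmetric] mult_mat_vec_zero ZDu QZ)
    have Du: "D *\<^sub>v u = 0\<^sub>v n" using * Qy c u by (simp add: y_def[symmetric] right_zero_vec[of _ n])
    \<comment> \<open>\<open>D *\<^sub>v u\<close> being zero, \<open>u\<close> is supported where
      the diagonal of \<open>D\<close> vanishes, and there \<open>Z\<close> is the identity.\<close>
    have "y = u"
    proof (rule eq_vecI)
      fix i assume "i < dim_vec u"
      then have i: "i < n" using u by simp
      have "(D *\<^sub>v u) $ i = D $$ (i,i) * u $ i"
      proof -
        have "(D *\<^sub>v u) $ i = (\<Sum>j<n. D $$ (i,j) * u $ j)"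
          using c u i by (simp add: scalar_prod_def atLeast0LessThan)
        also have "\<dots> = (\<Sum>j<n. if j = i then D $$ (i,i) * u $ i else 0)"
          using D c i by (intro sum.cong) (auto simp: diagonal_mat_def)
        finally show ?thesis using i by simp
      qed
      then have "D $$ (i,i) * u $ i = 0" using Du i by simp
      moreover have "y $ i = (if D $$ (i,i) = 0 then 1 else 0) * u $ i"
      proof -
        have "y $ i = (\<Sum>j<n. Z $$ (i,j) * u $ j)"
          using Z u i by (simp add: y_def scalar_prod_def atLeast0LessThan)
        also have "\<dots> = (\<Sum>j<n. if j = i then (if D $$ (i,i) = 0 then 1 else 0) * u $ i else 0)"
          using i by (intro sum.cong) (auto simp: Z_def mat_diag_def)
        finally show ?thesis using i by simp
      qed
      ultimately show "y $ i = u $ i" by auto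
    qed (use y u in auto)
    have "V *\<^sub>v u = v" unfolding u_def using c v w(1) by (simp add: assoc_mult_mat_vec[of _ n n _ n, symmetric])
    have "P *\<^sub>v v = V *\<^sub>v (D *\<^sub>v u)"
      using c u v P by (simp add: w(3) u_def assoc_mult_mat_vec[of _ n n _ n])
    then have "P *\<^sub>v v = 0\<^sub>v n" using Du c by (simp add: mult_mat_vec_zero)
    moreover have "Q *\<^sub>v v = 0\<^sub>v n"
    proof -
      have "V *\<^sub>v (Q' *\<^sub>v u) = ((V * W) * (Q * V)) *\<^sub>v u"
        using c Q u by (simp add: Q'_def assoc assoc_mult_mat_vec[of _ n n _ n, symmetric])
      also have "\<dots> = Q *\<^sub>v (V *\<^sub>v u)" using c Q u by (simp add: w(1) left_mult_one_mat[of _ n n] assoc_mult_mat_vec[of _ n n _ n])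
      finally show ?thesis using Qy c \<open>y = u\<close> by (simp add: \<open>V *\<^sub>v u = v\<close> mult_mat_vec_zero)
    qed
    ultimately show False using ker v by blast
  qed
  then show ?thesis using c by blast
qed

lemma det_adjoint: "A \<in> carrier_mat n n \<Longrightarrow> det (mat_adjoint A) = cnj (det A)"
proof -
  assume A: "A \<in> carrier_mat n n"
  interpret comm_ring_hom cnj by unfold_locales auto
  have "mat_adjoint A = transpose_mat (map_mat cnj A)" by (rule eq_matI) (use A in auto)
  then show ?thesis using A by (simp add: det_transpose[of _ n])
qed

text \<open>A kernel vector of the row Gram matrix is annihilated by P^H and Q^H, hence by (P + Q
  E)^H for every E; \<open>commuting_diagonalizable_pencil\<close> supplies an E for which P + Q E
  is invertible. The positive definite column Gram matrix excludes a common kernel of P and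
  Q.\<close>

lemma row_gram_det_nonzero:
  assumes P: "P \<in> carrier_mat n n" and Q: "Q \<in> carrier_mat n n" and PQ: "P * Q = Q * P"
    and d: "diagonalizable P" and pd: "pos_definite (mat_adjoint P * P + mat_adjoint Q * Q)"
  shows "det (P * mat_adjoint P + Q * mat_adjoint Q) \<noteq> 0"
proof
  have qf: "quad_form (mat_adjoint X * X + mat_adjoint Y * Y) v = (norm2_vec (X *\<^sub>v v))\<^sup>2 + (norm2_vec (Y *\<^sub>v v))\<^sup>2"
    if "X \<in> carrier_mat n n" "Y \<in> carrier_mat n n" "v \<in> carrier_vec n" for X Y v
    using that by (subst quad_form_add[of _ n]) (auto simp: quad_form_adjoint_mult[of _ n n])
  assume "det (P * mat_adjoint P + Q * mat_adjoint Q) = 0"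
  then obtain v where v: "v \<in> carrier_vec n" "v \<noteq> 0\<^sub>v n" "(P * mat_adjoint P + Q * mat_adjoint Q) *\<^sub>v v = 0\<^sub>v n"
    using det_0_iff_vec_prod_zero_field[of "P * mat_adjoint P + Q * mat_adjoint Q" n] P Q by auto
  have "quad_form (P * mat_adjoint P + Q * mat_adjoint Q) v = 0" using v by (simp add: quad_form_def)
  then have "(norm2_vec (mat_adjoint P *\<^sub>v v))\<^sup>2 + (norm2_vec (mat_adjoint Q *\<^sub>v v))\<^sup>2 = 0"
    using qf[of "mat_adjoint P" "mat_adjoint Q" v] P Q v by simp
  then have "(norm2_vec (mat_adjoint P *\<^sub>v v))\<^sup>2 = 0" "(norm2_vec (mat_adjoint Q *\<^sub>v v))\<^sup>2 = 0"
    by (metis add_nonneg_eq_0_iff zero_le_power2)+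
  then have Pv: "mat_adjoint P *\<^sub>v v = 0\<^sub>v n" and Qv: "mat_adjoint Q *\<^sub>v v = 0\<^sub>v n"
    using norm2_vec_eq_0[of "mat_adjoint P *\<^sub>v v" n] norm2_vec_eq_0[of "mat_adjoint Q *\<^sub>v v" n] P Q v
      mult_mat_vec_carrier[of "mat_adjoint P" n n v] mult_mat_vec_carrier[of "mat_adjoint Q" n n v]
    by auto
  have "u = 0\<^sub>v n" if "u \<in> carrier_vec n" "P *\<^sub>v u = 0\<^sub>v n" "Q *\<^sub>v u = 0\<^sub>v n" for u
  proof (rule ccontr)
    assume "u \<noteq> 0\<^sub>v n"
    then have "quad_form (mat_adjoint P * P + mat_adjoint Q * Q) u > 0"
      using pd that P Q by (auto simp: pos_definite_def)
    then show False using qf[OF P Q that(1)] that by (simp add: norm2_vec_eq_0[of _ n])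
  qed
  from commuting_diagonalizable_pencil[OF P Q PQ d this] obtain E where E: "E \<in> carrier_mat n n"
    and dt: "det (P + Q * E) \<noteq> 0" by blast
  have "mat_adjoint (P + Q * E) = mat_adjoint P + mat_adjoint E * mat_adjoint Q"
    using P Q E by (simp add: mat_adjoint_add[of _ n n] mat_adjoint_mult[of _ n n _ n])
  then have "mat_adjoint (P + Q * E) *\<^sub>v v = mat_adjoint P *\<^sub>v v + mat_adjoint E *\<^sub>v (mat_adjoint Q *\<^sub>v v)"
    using P Q E v by (simp add: add_mult_distrib_mat_vec[of _ n n] assoc_mult_mat_vec[of _ n n _ n])
  also have "\<dots> = 0\<^sub>v n" using E by (simp add: Pv Qv mult_mat_vec_zero[of _ n n])
  finally have "det (mat_adjoint (P + Q * E)) = 0"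
    using v P Q E det_0_iff_vec_prod_zero_field[of "mat_adjoint (P + Q * E)" n] by auto
  then show False using dt det_adjoint[of "P + Q * E" n] P Q E by simp
qed

text \<open>
  The $2n \times 2n$ matrix with block rows $(P, Q^H)$ and $(Q, -P^H)$ has orthogonal block columns, so
  $S$ and $T$ give a left inverse; both identities are blocks of the statement that it is a right inverse.
\<close>
lemma commuting_pair_resolution:
  fixes P Q S T :: "complex mat"
  assumes P: "P \<in> carrier_mat n n" and Q: "Q \<in> carrier_mat n n" and PQ: "P * Q = Q * P"
    and S: "S \<in> carrier_mat n n" "S * (mat_adjoint P * P + mat_adjoint Q * Q) = 1\<^sub>m n"
    and T: "T \<in> carrier_mat n n" "T * (P * mat_adjoint P + Q * mat_adjoint Q) = 1\<^sub>m n"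
  shows "P * (S * mat_adjoint P) + mat_adjoint Q * (T * Q) = 1\<^sub>m n"
    and "P * (S * mat_adjoint Q) = mat_adjoint Q * (T * P)"
proof -
  define P' Q' where "P' = mat_adjoint P" and "Q' = mat_adjoint Q"
  have c: "P \<in> carrier_mat n n" "Q \<in> carrier_mat n n" "P' \<in> carrier_mat n n" "Q' \<in> carrier_mat n n"
    "S \<in> carrier_mat n n" "T \<in> carrier_mat n n"
    using P Q S T by (auto simp: P'_def Q'_def)
  note assoc = assoc_mult_mat[of _ n n _ n _ n]
  have PQ': "P' * Q' = Q' * P'"
    unfolding P'_def Q'_def using mat_adjoint_mult[OF P Q] mat_adjoint_mult[OF Q P] PQ by simp
  define M where "M = four_block_mat P Q' Q (- P')"
  define N where "N = four_block_mat (S * P') (S * Q') (T * Q) (- (T * P))"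
  have M: "M \<in> carrier_mat (n+n) (n+n)" and N: "N \<in> carrier_mat (n+n) (n+n)"
    using c by (auto simp: M_def N_def)
  have um: "- X + X = 0\<^sub>m n n" "X + - X = 0\<^sub>m n n" if "X \<in> carrier_mat n n" for X :: "complex mat"
    using that by (auto intro!: eq_matI)
  have "S * P' * P + S * Q' * Q = 1\<^sub>m n"
    using S c by (simp add: P'_def[symmetric] Q'_def[symmetric] mult_add_distrib_mat[of _ n n _ n] assoc)
  moreover have "S * P' * Q' + S * Q' * (- P') = 0\<^sub>m n n"
    using c by (simp add: assoc PQ' um)
  moreover have "T * Q * P + (- (T * P)) * Q = 0\<^sub>m n n"
    using c by (simp add: assoc PQ um)
  moreover have "T * Q * Q' + (- (T * P)) * (- P') = 1\<^sub>m n"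
  proof -
    have "T * Q * Q' + (- (T * P)) * (- P') = T * P * P' + T * Q * Q'"
      using c by (simp add: comm_add_mat[of _ n n])
    then show ?thesis using T c by (simp add: P'_def[symmetric] Q'_def[symmetric] mult_add_distrib_mat[of _ n n _ n] assoc)
  qed
  ultimately have "N * M = 1\<^sub>m (n + n)"
    unfolding M_def N_def by (subst mult_four_block_mat[of _ n n _ n _ n _ _ n _ n]) (use c in auto)
  then have "M * N = 1\<^sub>m (n + n)" by (rule mat_mult_left_right_inverse[OF N M])
  moreover have "M * N = four_block_mat (P * (S * P') + Q' * (T * Q)) (P * (S * Q') + Q' * (- (T * P)))
     (Q * (S * P') + (- P') * (T * Q)) (Q * (S * Q') + (- P') * (- (T * P)))"
    unfolding M_def N_def by (subst mult_four_block_mat[of _ n n _ n _ n _ _ n _ n]) (use c in auto)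
  ultimately have F: "four_block_mat (P * (S * P') + Q' * (T * Q)) (P * (S * Q') + Q' * (- (T * P)))
     (Q * (S * P') + (- P') * (T * Q)) (Q * (S * Q') + (- P') * (- (T * P))) = 1\<^sub>m (n + n)" by simp
  show "P * (S * mat_adjoint P) + mat_adjoint Q * (T * Q) = 1\<^sub>m n"
  proof (rule eq_matI)
    fix i j assume "i < dim_row (1\<^sub>m n :: complex mat)" "j < dim_col (1\<^sub>m n :: complex mat)"
    then show "(P * (S * mat_adjoint P) + mat_adjoint Q * (T * Q)) $$ (i,j) = 1\<^sub>m n $$ (i,j)"
      using arg_cong[OF F, of "\<lambda>X. X $$ (i,j)"] c
      by (simp add: P'_def[symmetric] Q'_def[symmetric] del: index_mult_mat(1) index_add_mat(1))
  qed (use c in \<open>auto simp: Q'_def[symmetric]\<close>)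
  show "P * (S * mat_adjoint Q) = mat_adjoint Q * (T * P)"
  proof (rule eq_matI)
    fix i j assume "i < dim_row (mat_adjoint Q * (T * P))" "j < dim_col (mat_adjoint Q * (T * P))"
    then have ij: "i < n" "j < n" using c by auto
    \<comment> \<open>Column j + n lies in the upper right block, where the identity matrix
      vanishes.\<close>
    then have "(P * (S * Q') + Q' * (- (T * P))) $$ (i,j) = 0"
      using arg_cong[OF F, of "\<lambda>X. X $$ (i,j+n)"] c
      by (simp del: index_mult_mat(1) index_add_mat(1))
    then show "(P * (S * mat_adjoint Q)) $$ (i,j) = (mat_adjoint Q * (T * P)) $$ (i,j)"
      using ij c by (simp add: Q'_def[symmetric] del: index_mult_mat(1))
  qed (use c in \<open>auto simp: Q'_def[symmetric]\<close>)
qed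

text \<open>The two identities of \<open>commuting_pair_resolution\<close> split x into P S P^H x +
  Q^H T Q x and turn P S Q^H y into Q^H T P y. Subtracting P w cancels P S P^H x, and what is left
  combines to Q^H T (Q x - P y).\<close>

lemma commuting_pair_residual:
  fixes P Q S T :: "complex mat"
  assumes P: "P \<in> carrier_mat n n" and Q: "Q \<in> carrier_mat n n" and PQ: "P * Q = Q * P"
    and S: "S \<in> carrier_mat n n" "S * (mat_adjoint P * P + mat_adjoint Q * Q) = 1\<^sub>m n"
    and T: "T \<in> carrier_mat n n" "T * (P * mat_adjoint P + Q * mat_adjoint Q) = 1\<^sub>m n"
    and x: "x \<in> carrier_vec n" and y: "y \<in> carrier_vec n"
  defines "w \<equiv> S *\<^sub>v (mat_adjoint P *\<^sub>v x + mat_adjoint Q *\<^sub>v y)"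
  shows "x - P *\<^sub>v w = (mat_adjoint Q * T) *\<^sub>v (Q *\<^sub>v x - P *\<^sub>v y)"
proof -
  define P' Q' where "P' = mat_adjoint P" and "Q' = mat_adjoint Q"
  have c: "P \<in> carrier_mat n n" "Q \<in> carrier_mat n n" "P' \<in> carrier_mat n n" "Q' \<in> carrier_mat n n"
    "S \<in> carrier_mat n n" "T \<in> carrier_mat n n"
    using P Q S T by (auto simp: P'_def Q'_def)
  note av = assoc_mult_mat_vec[of _ n n _ n]
  note res = commuting_pair_resolution[OF P Q PQ S T, folded P'_def Q'_def]
  have mc: "A *\<^sub>v v \<in> carrier_vec n" if "A \<in> carrier_mat n n" for A and v :: "complex vec"
    using that by (intro carrier_vecI) auto
  have xx: "x = P *\<^sub>v (S *\<^sub>v (P' *\<^sub>v x)) + Q' *\<^sub>v (T *\<^sub>v (Q *\<^sub>v x))"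
  proof -
    have "x = (P * (S * P') + Q' * (T * Q)) *\<^sub>v x" using res(1) x by simp
    also have "\<dots> = P *\<^sub>v (S *\<^sub>v (P' *\<^sub>v x)) + Q' *\<^sub>v (T *\<^sub>v (Q *\<^sub>v x))"
      using c x by (simp add: add_mult_distrib_mat_vec[of _ n n] av mc)
    finally show ?thesis .
  qed
  have yy: "P *\<^sub>v (S *\<^sub>v (Q' *\<^sub>v y)) = Q' *\<^sub>v (T *\<^sub>v (P *\<^sub>v y))"
  proof -
    have "(P * (S * Q')) *\<^sub>v y = (Q' * (T * P)) *\<^sub>v y" using res(2) by simp
    then show ?thesis using c y by (simp add: av mc)
  qed
  have "P *\<^sub>v w = P *\<^sub>v (S *\<^sub>v (P' *\<^sub>v x)) + P *\<^sub>v (S *\<^sub>v (Q' *\<^sub>v y))"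
    unfolding w_def P'_def[symmetric] Q'_def[symmetric] using c
    by (simp add: mult_add_distrib_mat_vec[of _ n n] mc)
  moreover have "(Q' * T) *\<^sub>v (Q *\<^sub>v x - P *\<^sub>v y) = Q' *\<^sub>v (T *\<^sub>v (Q *\<^sub>v x)) - Q' *\<^sub>v (T *\<^sub>v (P *\<^sub>v y))"
    using c by (simp add: mult_minus_distrib_mat_vec[of _ n n] av mc minus_carrier_vec)
  moreover have "x - (a + b) = e - b" if "x = a + e" "a \<in> carrier_vec n" "b \<in> carrier_vec n" "e \<in> carrier_vec n" for a b e
    unfolding that(1) using that(2-) by (intro eq_vecI) auto
  ultimately show ?thesis unfolding Q'_def[symmetric] using xx yy mc c by metis
qed

text \<open>The normal equations stay in the conclusion because minimality of the global solution is
  read off from them. The bound mentions only Q x and P y, the two quantities that hypothesis (i)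
  controls.\<close>

lemma commuting_pair_least_squares:
  fixes P Q S T :: "complex mat"
  assumes P: "P \<in> carrier_mat n n" and Q: "Q \<in> carrier_mat n n" and PQ: "P * Q = Q * P"
    and S: "S \<in> carrier_mat n n" "S * (mat_adjoint P * P + mat_adjoint Q * Q) = 1\<^sub>m n"
    and T: "T \<in> carrier_mat n n" "T * (P * mat_adjoint P + Q * mat_adjoint Q) = 1\<^sub>m n"
    and cP: "\<And>i j. i < n \<Longrightarrow> j < n \<Longrightarrow> cmod ((mat_adjoint P * T) $$ (i,j)) \<le> c"
    and cQ: "\<And>i j. i < n \<Longrightarrow> j < n \<Longrightarrow> cmod ((mat_adjoint Q * T) $$ (i,j)) \<le> c"
    and x: "x \<in> carrier_vec n" and y: "y \<in> carrier_vec n"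
  shows "\<exists>w \<in> carrier_vec n.
      mat_adjoint P *\<^sub>v (x - P *\<^sub>v w) + mat_adjoint Q *\<^sub>v (y - Q *\<^sub>v w) = 0\<^sub>v n \<and>
      (norm2_vec (x - P *\<^sub>v w))\<^sup>2 + (norm2_vec (y - Q *\<^sub>v w))\<^sup>2
        \<le> 4 * (real n * real n * c\<^sup>2) * ((norm2_vec (Q *\<^sub>v x))\<^sup>2 + (norm2_vec (P *\<^sub>v y))\<^sup>2)"
proof -
  define w where "w = S *\<^sub>v (mat_adjoint P *\<^sub>v x + mat_adjoint Q *\<^sub>v y)"
  define P' Q' where "P' = mat_adjoint P" and "Q' = mat_adjoint Q"
  have c: "P \<in> carrier_mat n n" "Q \<in> carrier_mat n n" "P' \<in> carrier_mat n n" "Q' \<in> carrier_mat n n"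
    "S \<in> carrier_mat n n" "T \<in> carrier_mat n n"
    using P Q S T by (auto simp: P'_def Q'_def)
  have mc: "A *\<^sub>v v \<in> carrier_vec n" if "A \<in> carrier_mat n n" for A and v :: "complex vec"
    using that by (intro carrier_vecI) auto
  have w: "w \<in> carrier_vec n" using mc[OF S(1)] by (simp add: w_def)
  have S': "S * (Q' * Q + P' * P) = 1\<^sub>m n" and T': "T * (Q * Q' + P * P') = 1\<^sub>m n"
    using S T c by (simp_all add: P'_def Q'_def comm_add_mat[of _ n n])
  have r1: "x - P *\<^sub>v w = (Q' * T) *\<^sub>v (Q *\<^sub>v x - P *\<^sub>v y)"
    using commuting_pair_residual[OF P Q PQ S T x y] by (simp add: w_def Q'_def)
  \<comment> \<open>The second residual is the first with (P, x) and (Q, y) exchanged; both Gram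
    matrices are invariant under this exchange, so S, T and \<open>w\<close> stay the same.\<close>
  have r2: "y - Q *\<^sub>v w = (P' * T) *\<^sub>v (P *\<^sub>v y - Q *\<^sub>v x)"
    using commuting_pair_residual[OF Q P PQ[symmetric] S(1) _ T(1) _ y x] S' T' c
    by (simp add: w_def Q'_def P'_def comm_add_vec[of _ n] mc)
  define z where "z = Q *\<^sub>v x - P *\<^sub>v y"
  have z: "z \<in> carrier_vec n" "P *\<^sub>v y - Q *\<^sub>v x = - z" "norm2_vec (P *\<^sub>v y - Q *\<^sub>v x) = norm2_vec z"
  proof -
    show "z \<in> carrier_vec n" using c mc by (auto simp: z_def)
    show 1: "P *\<^sub>v y - Q *\<^sub>v x = - z" unfolding z_def using c by (intro eq_vecI) auto
    show "norm2_vec (P *\<^sub>v y - Q *\<^sub>v x) = norm2_vec z" by (simp add: 1)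
  qed
  have "(norm2_vec z)\<^sup>2 \<le> 2 * (norm2_vec (Q *\<^sub>v x))\<^sup>2 + 2 * (norm2_vec (P *\<^sub>v y))\<^sup>2"
  proof -
    have "z = Q *\<^sub>v x + - (P *\<^sub>v y)" unfolding z_def using c by (intro eq_vecI) auto
    then show ?thesis using norm2_vec_add_sq_le[of "Q *\<^sub>v x" n "- (P *\<^sub>v y)"] c mc by simp
  qed
  then have zle: "real n * real n * c\<^sup>2 * (norm2_vec z)\<^sup>2
     \<le> real n * real n * c\<^sup>2 * (2 * (norm2_vec (Q *\<^sub>v x))\<^sup>2 + 2 * (norm2_vec (P *\<^sub>v y))\<^sup>2)"
    by (rule mult_left_mono) simp
  have "(norm2_vec (x - P *\<^sub>v w))\<^sup>2 \<le> real n * real n * c\<^sup>2 * (norm2_vec z)\<^sup>2"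
    unfolding r1 z_def[symmetric] by (rule norm2_mult_mat_vec_le) (use c z cQ in \<open>auto simp: Q'_def\<close>)
  moreover have "(norm2_vec (y - Q *\<^sub>v w))\<^sup>2 \<le> real n * real n * c\<^sup>2 * (norm2_vec z)\<^sup>2"
    unfolding r2 z(3)[symmetric] by (rule norm2_mult_mat_vec_le) (use c z cP in \<open>auto simp: P'_def\<close>)
  \<comment> \<open>Factor 4: two residual blocks with the same bound, times 2 from |a - b|^2 \<le>
    2 |a|^2 + 2 |b|^2.\<close>
  ultimately have "(norm2_vec (x - P *\<^sub>v w))\<^sup>2 + (norm2_vec (y - Q *\<^sub>v w))\<^sup>2
        \<le> 4 * (real n * real n * c\<^sup>2) * ((norm2_vec (Q *\<^sub>v x))\<^sup>2 + (norm2_vec (P *\<^sub>v y))\<^sup>2)"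
    using zle by (simp add: algebra_simps)
  moreover have "P' *\<^sub>v (x - P *\<^sub>v w) + Q' *\<^sub>v (y - Q *\<^sub>v w) = 0\<^sub>v n"
  proof -
    define h where "h = P' *\<^sub>v x + Q' *\<^sub>v y"
    have h: "h \<in> carrier_vec n" using c mc by (auto simp: h_def)
    \<comment> \<open>\<open>S\<close> is given as a left inverse; the normal equations need it as a
      right inverse.\<close>
    have "(P' * P + Q' * Q) * S = 1\<^sub>m n"
      by (rule mat_mult_left_right_inverse[OF S(1)]) (use c S in \<open>auto simp: P'_def Q'_def\<close>)
    then have "h = ((P' * P + Q' * Q) * S) *\<^sub>v h" using h by simp
    also have "\<dots> = (P' * P + Q' * Q) *\<^sub>v w"
    proof -
      have "w = S *\<^sub>v h" by (simp add: w_def h_def P'_def Q'_def)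
      then show ?thesis using c h by (simp add: assoc_mult_mat_vec[of _ n n S n h])
    qed
    also have "\<dots> = P' *\<^sub>v (P *\<^sub>v w) + Q' *\<^sub>v (Q *\<^sub>v w)"
      using c w by (simp add: add_mult_distrib_mat_vec[of _ n n] assoc_mult_mat_vec[of _ n n _ n])
    finally have hw: "h = P' *\<^sub>v (P *\<^sub>v w) + Q' *\<^sub>v (Q *\<^sub>v w)" .
    have "P' *\<^sub>v (x - P *\<^sub>v w) + Q' *\<^sub>v (y - Q *\<^sub>v w)
        = h - (P' *\<^sub>v (P *\<^sub>v w) + Q' *\<^sub>v (Q *\<^sub>v w))"
      using c x y w by (simp add: mult_minus_distrib_mat_vec[of _ n n] mc h_def) (intro eq_vecI, auto)
    then show ?thesis using h hw by (metis minus_cancel_vec)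
  qed
  ultimately show ?thesis using w by (auto simp: P'_def Q'_def)
qed

section \<open>Matrix-valued trigonometric polynomials\<close>

lemma exp_of_int_cis: "exp (\<i> * of_int j * of_real \<theta>) = cis (of_int j * \<theta>)"
  by (simp add: cis_conv_exp mult.assoc)

lemma trig_poly_carrier: "trig_poly d g \<Longrightarrow> g \<theta> \<in> carrier_mat d d"
  by (auto simp: trig_poly_def)

lemma trig_poly_periodic:
  assumes "trig_poly d g"
  shows "g (\<theta> + 2 * pi * of_int m) = g \<theta>"
proof -
  have "cis (of_int j * (\<theta> + 2 * pi * of_int m)) = cis (of_int j * \<theta>)" for j :: int
  proof -
    have "of_int j * (\<theta> + 2 * pi * of_int m) = of_int j * \<theta> + 2 * pi * of_int (j * m)"
      by (simp add: algebra_simps)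
    then show ?thesis by (simp add: cis_mult[symmetric] del: of_int_mult)
  qed
  then show ?thesis using assms by (auto simp: trig_poly_def exp_of_int_cis)
qed

lemma trig_poly_periodic_pi: "trig_poly d g \<Longrightarrow> g (\<theta> + pi + pi) = g \<theta>"
  using trig_poly_periodic[of d g \<theta> 1] by (simp add: add.assoc)

lemma angle_reduction: "\<exists>\<theta>' \<in> {0..<2*pi}. \<exists>m. \<theta> = \<theta>' + 2 * pi * of_int m"
proof -
  define m where "m = \<lfloor>\<theta> / (2 * pi)\<rfloor>"
  have "of_int m \<le> \<theta> / (2 * pi)" "\<theta> / (2 * pi) < of_int m + 1" by (simp_all add: m_def)
  then have "\<theta> - 2 * pi * of_int m \<in> {0..<2*pi}" by (simp add: field_simps)
  then show ?thesis by (intro bexI[of _ "\<theta> - 2 * pi * of_int m"] exI[of _ m]) auto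
qed

text \<open>Injectivity lets roots of a polynomial on the unit circle be counted as angles, and
  later separates the nodes of the Fourier matrix.\<close>

lemma inj_on_cis: "inj_on cis {0..<2 * pi}"
proof (rule inj_onI)
  fix x y assume xy: "x \<in> {0..<2*pi}" "y \<in> {0..<2*pi}" "cis x = cis y"
  then have "sin x = sin y \<and> cos x = cos y" by (simp add: complex_eq_iff)
  then obtain n :: int where n: "x = y + 2 * pi * of_int n" using sin_cos_eq_iff by metis
  have "\<not> real_of_int n \<ge> 1"
  proof
    assume "real_of_int n \<ge> 1"
    then have "2 * pi * 1 \<le> 2 * pi * real_of_int n" by (intro mult_left_mono) auto
    then show False using xy(1,2) n unfolding atLeastLessThan_iff by linarith
  qed
  moreover have "\<not> real_of_int n \<le> -1"
  proof
    assume "real_of_int n \<le> -1"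
    then have "2 * pi * real_of_int n \<le> 2 * pi * (-1)" by (intro mult_left_mono) auto
    then show False using xy(1,2) n unfolding atLeastLessThan_iff by linarith
  qed
  ultimately have "n = 0" by linarith
  then show "x = y" using n by auto
qed

lemma trig_poly_det_finite_zeros:
  assumes tp: "trig_poly d g" and nz: "det (g \<theta>0) \<noteq> 0"
  shows "finite {\<theta> \<in> {0..<2*pi}. det (g \<theta>) = 0}"
proof -
  from tp obtain r c where g: "\<And>\<theta>. g \<theta> = mat d d (\<lambda>(a,b). \<Sum>j \<in> {- int r..int r}. c j $$ (a,b) * cis (of_int j * \<theta>))"
    by (auto simp: trig_poly_def exp_of_int_cis)
  \<comment> \<open>multiplying the entries of \<open>g\<close> by $e^{\iota r\theta}$ makes them polynomials in $e^{\iota\theta}$\<close>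
  define q where "q = mat d d (\<lambda>(a,b). \<Sum>j \<in> {- int r..int r}. monom (c j $$ (a,b)) (nat (j + int r)))"
  have "map_mat (\<lambda>u. poly u (cis \<theta>)) q = cis \<theta> ^ r \<cdot>\<^sub>m g \<theta>" for \<theta>
  proof (rule eq_matI)
    fix a b assume "a < dim_row (cis \<theta> ^ r \<cdot>\<^sub>m g \<theta>)" "b < dim_col (cis \<theta> ^ r \<cdot>\<^sub>m g \<theta>)"
    then have ab: "a < d" "b < d" by (auto simp: g)
    have "cis \<theta> ^ nat (j + int r) = cis \<theta> ^ r * cis (of_int j * \<theta>)" if "j \<in> {- int r..int r}" for j
      using that by (simp add: DeMoivre cis_mult of_nat_nat algebra_simps)
    then show "map_mat (\<lambda>u. poly u (cis \<theta>)) q $$ (a,b) = (cis \<theta> ^ r \<cdot>\<^sub>m g \<theta>) $$ (a,b)"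
      using ab by (auto simp: g q_def poly_sum poly_monom sum_distrib_left mult_ac intro!: sum.cong)
  qed (auto simp: g q_def)
  moreover have "det (map_mat (\<lambda>u. poly u z) q) = poly (det q) z" for z
    by (rule comm_ring_hom.hom_det[OF poly_hom.comm_ring_hom_axioms])
  \<comment> \<open>The factor in front never vanishes, so det g(\<theta>) is zero only if cis
    \<theta> is a root of \<open>det q\<close>, and the angle \<theta>0 shows that
    \<open>det q\<close> is not the zero polynomial.\<close>
  ultimately have eq: "poly (det q) (cis \<theta>) = (cis \<theta> ^ r) ^ d * det (g \<theta>)" for \<theta>
    using trig_poly_carrier[OF tp, of \<theta>] det_smult[of "cis \<theta> ^ r" "g \<theta>"] by (metis carrier_matD(2))
  then have "det q \<noteq> 0" using nz by (metis mult_eq_0_iff poly_0 power_not_zero cis_neq_zero)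
  then have "finite {z. poly (det q) z = 0}" by (rule poly_roots_finite)
  moreover have "cis ` {\<theta> \<in> {0..<2*pi}. det (g \<theta>) = 0} \<subseteq> {z. poly (det q) z = 0}" using eq by auto
  ultimately have "finite (cis ` {\<theta> \<in> {0..<2*pi}. det (g \<theta>) = 0})" by (rule rev_finite_subset)
  then show ?thesis by (rule finite_imageD) (rule inj_on_subset[OF inj_on_cis], auto)
qed

section \<open>Continuity and boundedness of matrix functions of the angle\<close>

definition entries_continuous :: "nat \<Rightarrow> (real \<Rightarrow> complex mat) \<Rightarrow> bool" where
  "entries_continuous n g \<longleftrightarrow> (\<forall>\<theta>. g \<theta> \<in> carrier_mat n n) \<and>
     (\<forall>i<n. \<forall>j<n. continuous_on UNIV (\<lambda>\<theta>. g \<theta> $$ (i,j)))"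

lemma entries_continuousD:
  "entries_continuous n g \<Longrightarrow> g \<theta> \<in> carrier_mat n n"
  "entries_continuous n g \<Longrightarrow> i < n \<Longrightarrow> j < n \<Longrightarrow> continuous_on UNIV (\<lambda>\<theta>. g \<theta> $$ (i,j))"
  by (auto simp: entries_continuous_def)

lemma entries_continuous_trig_poly: "trig_poly d g \<Longrightarrow> entries_continuous d g"
  by (auto simp: trig_poly_def entries_continuous_def intro!: continuous_intros)

lemma entries_continuous_adjoint:
  assumes "entries_continuous n g"
  shows "entries_continuous n (\<lambda>\<theta>. mat_adjoint (g \<theta>))"
proof -
  have "mat_adjoint (g \<theta>) $$ (i,j) = cnj (g \<theta> $$ (j,i))" if "i < n" "j < n" for \<theta> i j
    using that entries_continuousD(1)[OF assms, of \<theta>] by simp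
  then show ?thesis using assms by (auto simp: entries_continuous_def intro!: continuous_intros)
qed

lemma entries_continuous_add:
  assumes "entries_continuous n g" "entries_continuous n h"
  shows "entries_continuous n (\<lambda>\<theta>. g \<theta> + h \<theta>)"
proof -
  have "(g \<theta> + h \<theta>) $$ (i,j) = g \<theta> $$ (i,j) + h \<theta> $$ (i,j)" if "i < n" "j < n" for \<theta> i j
    using that entries_continuousD(1)[OF assms(1), of \<theta>] entries_continuousD(1)[OF assms(2), of \<theta>] by simp
  then show ?thesis using assms by (auto simp: entries_continuous_def intro!: continuous_intros)
qed

lemma entries_continuous_mult:
  assumes "entries_continuous n g" "entries_continuous n h"
  shows "entries_continuous n (\<lambda>\<theta>. g \<theta> * h \<theta>)"
proof -
  have "(g \<theta> * h \<theta>) $$ (i,j) = (\<Sum>k<n. g \<theta> $$ (i,k) * h \<theta> $$ (k,j))" if "i < n" "j < n" for \<theta> i j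
    using that entries_continuousD(1)[OF assms(1), of \<theta>] entries_continuousD(1)[OF assms(2), of \<theta>]
    by (simp add: scalar_prod_def atLeast0LessThan)
  then show ?thesis using assms by (auto simp: entries_continuous_def intro!: continuous_intros)
qed

lemma entries_continuous_shift:
  assumes "entries_continuous n g"
  shows "entries_continuous n (\<lambda>\<theta>. g (\<theta> + a))"
proof -
  have "continuous_on UNIV (\<lambda>\<theta>. g (\<theta> + a) $$ (i,j))" if "i < n" "j < n" for i j
  proof -
    have "continuous_on UNIV (\<lambda>\<theta>::real. \<theta> + a)" by (intro continuous_intros)
    then show ?thesis using continuous_on_compose2[OF entries_continuousD(2)[OF assms that]] by blast
  qed
  then show ?thesis using assms by (auto simp: entries_continuous_def)
qed

lemma continuous_on_det:
  assumes "entries_continuous n g"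
  shows "continuous_on UNIV (\<lambda>\<theta>. det (g \<theta>))"
proof -
  have "det (g \<theta>) = (\<Sum>p \<in> {p. p permutes {0..<n}}. signof p * (\<Prod>i = 0..<n. g \<theta> $$ (i, p i)))" for \<theta>
    by (rule det_def'[OF entries_continuousD(1)[OF assms]])
  moreover have "continuous_on UNIV (\<lambda>\<theta>. g \<theta> $$ (i, p i))" if "p permutes {0..<n}" "i \<in> {0..<n}" for p i
    using entries_continuousD(2)[OF assms, of i "p i"] that permutes_in_image[OF that(1)] by auto
  ultimately show ?thesis by (auto intro!: continuous_intros)
qed

text \<open>Each entry of the adjugate is a signed determinant of a minor, whose entries are those
  of \<open>g\<close> at indices that jump over one row and one column.\<close>

lemma entries_continuous_adj_mat:
  assumes "entries_continuous n g"
  shows "entries_continuous n (\<lambda>\<theta>. adj_mat (g \<theta>))"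
proof -
  note c = entries_continuousD(1)[OF assms]
  have "continuous_on UNIV (\<lambda>\<theta>. adj_mat (g \<theta>) $$ (i,j))" if ij: "i < n" "j < n" for i j
  proof -
    have "entries_continuous (n - 1) (\<lambda>\<theta>. mat_delete (g \<theta>) j i)"
      unfolding entries_continuous_def
    proof (intro conjI allI impI)
      show "mat_delete (g \<theta>) j i \<in> carrier_mat (n - 1) (n - 1)" for \<theta>
        using c[of \<theta>] by (rule mat_delete_carrier)
      fix a b assume ab: "a < n - 1" "b < n - 1"
      have "mat_delete (g \<theta>) j i $$ (a,b) = g \<theta> $$ (if a < j then a else Suc a, if b < i then b else Suc b)" for \<theta>
        using c[of \<theta>] ab by (simp add: mat_delete_def)
      then show "continuous_on UNIV (\<lambda>\<theta>. mat_delete (g \<theta>) j i $$ (a,b))"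
        using ab by (simp only:, intro entries_continuousD(2)[OF assms]) auto
    qed
    then have "continuous_on UNIV (\<lambda>\<theta>. (-1) ^ (j + i) * det (mat_delete (g \<theta>) j i))"
      by (intro continuous_intros continuous_on_det)
    moreover have "adj_mat (g \<theta>) $$ (i,j) = (-1) ^ (j + i) * det (mat_delete (g \<theta>) j i)" for \<theta>
      using c[of \<theta>] ij by (simp add: adj_mat_def cofactor_def)
    ultimately show ?thesis by simp
  qed
  then show ?thesis using adj_mat(1)[OF c] by (auto simp: entries_continuous_def)
qed

lemma entries_continuous_inverse:
  assumes g: "entries_continuous n g" and nz: "\<And>\<theta>. det (g \<theta>) \<noteq> 0"
  shows "entries_continuous n (\<lambda>\<theta>. inverse (det (g \<theta>)) \<cdot>\<^sub>m adj_mat (g \<theta>))"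
proof -
  note a = entries_continuous_adj_mat[OF g]
  have "(inverse (det (g \<theta>)) \<cdot>\<^sub>m adj_mat (g \<theta>)) $$ (i,j) = inverse (det (g \<theta>)) * adj_mat (g \<theta>) $$ (i,j)"
    if "i < n" "j < n" for \<theta> i j
    using that entries_continuousD(1)[OF a, of \<theta>] by simp
  then show ?thesis using a nz
    by (auto simp: entries_continuous_def intro!: continuous_intros continuous_on_det[OF g])
qed

lemma entries_bounded:
  assumes g: "entries_continuous n g"
  shows "\<exists>c. \<forall>\<theta> \<in> {a..b}. \<forall>i<n. \<forall>j<n. cmod (g \<theta> $$ (i,j)) \<le> c"
proof (cases "a \<le> b")
  case True
  \<comment> \<open>One continuous function dominating all entries, so a single maximum on the
    compact interval bounds them simultaneously.\<close>
  define h where "h \<theta> = (\<Sum>i<n. \<Sum>j<n. cmod (g \<theta> $$ (i,j)))" for \<theta>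
  have "continuous_on {a..b} h" unfolding h_def
    by (intro continuous_intros continuous_on_subset[OF entries_continuousD(2)[OF g]]) auto
  then obtain x where x: "\<forall>y \<in> {a..b}. h y \<le> h x"
    using continuous_attains_sup[of "{a..b}" h] True by auto
  have "cmod (g \<theta> $$ (i,j)) \<le> h \<theta>" if "i < n" "j < n" for \<theta> i j
  proof -
    have "cmod (g \<theta> $$ (i,j)) \<le> (\<Sum>j<n. cmod (g \<theta> $$ (i,j)))" using that by (intro member_le_sum) auto
    also have "\<dots> \<le> h \<theta>" unfolding h_def
      using that by (intro member_le_sum[of i "{..<n}" "\<lambda>i. \<Sum>j<n. cmod (g \<theta> $$ (i,j))"]) (auto intro: sum_nonneg)
    finally show ?thesis .
  qed
  then show ?thesis using x by (meson order_trans)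
qed auto

lemma entries_continuous_norm2:
  assumes g: "entries_continuous n g" and v: "v \<in> carrier_vec n"
  shows "continuous_on UNIV (\<lambda>\<theta>. (norm2_vec (g \<theta> *\<^sub>v v))\<^sup>2)"
proof -
  have "(norm2_vec (g \<theta> *\<^sub>v v))\<^sup>2 = (\<Sum>i<n. (cmod (\<Sum>j<n. g \<theta> $$ (i,j) * v $ j))\<^sup>2)" for \<theta>
    using entries_continuousD(1)[OF g, of \<theta>] v
    by (auto simp: norm2_vec_sq scalar_prod_def atLeast0LessThan intro!: sum.cong)
  then show ?thesis using g by (auto simp: entries_continuous_def intro!: continuous_intros)
qed

lemma entries_continuous_quad_form:
  assumes g: "entries_continuous n g" and v: "v \<in> carrier_vec n"
  shows "continuous_on UNIV (\<lambda>\<theta>. quad_form (g \<theta>) v)"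
proof -
  have "quad_form (g \<theta>) v = Re (\<Sum>i<n. (\<Sum>j<n. g \<theta> $$ (i,j) * v $ j) * cnj (v $ i))" for \<theta>
    using entries_continuousD(1)[OF g, of \<theta>] v
    by (auto simp: quad_form_def cscalar_prod_sum scalar_prod_def atLeast0LessThan intro!: sum.cong)
  then show ?thesis using g by (auto simp: entries_continuous_def intro!: continuous_intros)
qed

section \<open>The estimate at a single frequency\<close>

lemma pos_definite_of_nonsingular:
  assumes A: "A \<in> carrier_mat n n" and nn: "nonneg_definite A" and d: "det A \<noteq> 0"
  shows "pos_definite A"
  using pos_definite_iff[OF A] nn d det_0_iff_vec_prod_zero_field[OF A] by blast

lemma eigenvalue_0_iff_det:
  assumes A: "A \<in> carrier_mat n n"
  shows "eigenvalue A 0 \<longleftrightarrow> det (A :: complex mat) = 0"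
proof -
  have "0 \<cdot>\<^sub>v v = 0\<^sub>v n" if "v \<in> carrier_vec n" for v :: "complex vec"
    using that by (intro eq_vecI) auto
  then show ?thesis
    using A det_0_iff_vec_prod_zero_field[OF A] by (auto simp: eigenvalue_def eigenvector_def)
qed

lemma singular_angles_eq:
  assumes "trig_poly d f"
  shows "singular_angles f = {\<theta> \<in> {0..<2*pi}. det (f \<theta>) = 0}"
  using eigenvalue_0_iff_det[OF trig_poly_carrier[OF assms]] by (auto simp: singular_angles_def)

text \<open>If det f vanished identically, 0 would be a singular angle and f would be singular at
  the opposite angle too, against \<open>opp\<close>.\<close>

lemma finite_singular_angles:
  assumes f: "trig_poly d f"
    and opp: "\<forall>\<theta> \<in> singular_angles f. \<forall>l. eigenvalue (f (\<theta> + pi)) l \<longrightarrow> l \<noteq> 0"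
  shows "finite (singular_angles f)"
proof -
  have "\<exists>\<theta>. det (f \<theta>) \<noteq> 0"
  proof (rule ccontr)
    assume "\<not> ?thesis"
    then have "0 \<in> singular_angles f" "eigenvalue (f (0 + pi)) 0"
      using singular_angles_eq[OF f] eigenvalue_0_iff_det[OF trig_poly_carrier[OF f]] by auto
    then show False using opp by blast
  qed
  then show ?thesis using trig_poly_det_finite_zeros[OF f] singular_angles_eq[OF f] by auto
qed

lemma continuous_on_UNIV_at_right:
  "continuous_on UNIV f \<Longrightarrow> (f \<longlongrightarrow> f x) (at_right x)"
  by (auto simp: continuous_on_def intro: tendsto_within_subset)

text \<open>At a regular angle this is \<open>norm2_mult_le_quad_form\<close>. At a singular one
  \<open>inv_sqrt\<close> is unspecified, but both sides of the inequality are continuous in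
  \<theta>, so it passes to the limit.\<close>

lemma norm2_shifted_symbol_le:
  assumes f: "trig_poly d f" and nn: "\<forall>\<theta>. nonneg_definite (f \<theta>)"
    and fin: "finite (singular_angles f)" and p: "trig_poly d p"
    and c: "\<forall>\<theta> \<in> {0..<2 * pi} - singular_angles f. norm1_mat (inv_sqrt (f \<theta>) * mat_adjoint (p (\<theta> + pi))) < c"
    and v: "v \<in> carrier_vec d"
  shows "(norm2_vec (p (\<theta> + pi) *\<^sub>v v))\<^sup>2 \<le> real d * real d * c\<^sup>2 * quad_form (f \<theta>) v"
proof -
  note fc = trig_poly_carrier[OF f] and pc = trig_poly_carrier[OF p]
  have regular: "(norm2_vec (p (\<theta> + pi) *\<^sub>v v))\<^sup>2 \<le> real d * real d * c\<^sup>2 * quad_form (f \<theta>) v"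
    if \<theta>: "\<theta> \<in> {0..<2 * pi} - singular_angles f" for \<theta>
  proof (rule norm2_mult_le_quad_form[OF fc _ pc v])
    have "det (f \<theta>) \<noteq> 0" using \<theta> singular_angles_eq[OF f] by auto
    then show pd: "pos_definite (f \<theta>)" using pos_definite_of_nonsingular[OF fc] nn by blast
    fix i j assume ij: "i < d" "j < d"
    have "inv_sqrt (f \<theta>) * mat_adjoint (p (\<theta> + pi)) \<in> carrier_mat d d"
      using inv_sqrt_properties(1)[OF fc pd] pc by simp
    from cmod_le_norm1_mat[OF this ij]
    show "cmod ((inv_sqrt (f \<theta>) * mat_adjoint (p (\<theta> + pi))) $$ (i,j)) \<le> c"
      using bspec[OF c \<theta>] by linarith
  qed
  have all: "(norm2_vec (p (\<theta> + pi) *\<^sub>v v))\<^sup>2 \<le> real d * real d * c\<^sup>2 * quad_form (f \<theta>) v"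
    if \<theta>: "\<theta> \<in> {0..<2 * pi}" for \<theta>
  \<comment> \<open>Limits from the right: a small right neighbourhood of a point of the half-open
    interval stays inside it, also at 0, and avoids the finitely many singular angles.\<close>
  proof (rule tendsto_le[OF trivial_limit_at_right_real])
    have "continuous_on UNIV (\<lambda>\<theta>. real d * real d * c\<^sup>2 * quad_form (f \<theta>) v)"
      by (intro continuous_intros entries_continuous_quad_form[OF entries_continuous_trig_poly[OF f] v])
    then show "((\<lambda>\<theta>. real d * real d * c\<^sup>2 * quad_form (f \<theta>) v) \<longlongrightarrow> real d * real d * c\<^sup>2 * quad_form (f \<theta>) v) (at_right \<theta>)"
      by (rule continuous_on_UNIV_at_right)
    have "continuous_on UNIV (\<lambda>\<theta>. (norm2_vec (p (\<theta> + pi) *\<^sub>v v))\<^sup>2)"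
      by (rule entries_continuous_norm2[OF entries_continuous_shift[OF entries_continuous_trig_poly[OF p]] v])
    then show "((\<lambda>\<theta>. (norm2_vec (p (\<theta> + pi) *\<^sub>v v))\<^sup>2) \<longlongrightarrow> (norm2_vec (p (\<theta> + pi) *\<^sub>v v))\<^sup>2) (at_right \<theta>)"
      by (rule continuous_on_UNIV_at_right)
    have "eventually (\<lambda>x. \<forall>s \<in> singular_angles f. x \<noteq> s) (at_right \<theta>)"
      using fin by (intro eventually_ball_finite) (auto intro: eventually_neq_at_within)
    moreover have "eventually (\<lambda>x. x \<in> {0..<2*pi}) (at_right \<theta>)"
      by (rule eventually_at_rightI[of \<theta> "2 * pi"]) (use \<theta> in auto)
    ultimately show "eventually (\<lambda>\<theta>. (norm2_vec (p (\<theta> + pi) *\<^sub>v v))\<^sup>2 \<le> real d * real d * c\<^sup>2 * quad_form (f \<theta>) v) (at_right \<theta>)"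
      by eventually_elim (rule regular, auto)
  qed
  \<comment> \<open>All real angles are covered because the estimate is also used at \<theta> + pi,
    which may leave the interval.\<close>
  obtain \<theta>' m where \<theta>': "\<theta>' \<in> {0..<2*pi}" "\<theta> = \<theta>' + 2 * pi * of_int m" using angle_reduction by blast
  have "p (\<theta> + pi) = p (\<theta>' + pi)"
    using trig_poly_periodic[OF p, of "\<theta>' + pi" m] by (simp add: \<theta>'(2) algebra_simps)
  moreover have "f \<theta> = f \<theta>'" using trig_poly_periodic[OF f, of \<theta>' m] by (simp add: \<theta>'(2))
  ultimately show ?thesis using all[OF \<theta>'(1)] by simp
qed

lemma symbol_approximation:
  assumes f: "trig_poly d f" and nn: "\<forall>\<theta>. nonneg_definite (f \<theta>)"
    and opp: "\<forall>\<theta> \<in> singular_angles f. \<forall>l. eigenvalue (f (\<theta> + pi)) l \<longrightarrow> l \<noteq> 0"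
    and p: "trig_poly d p" and diag: "\<forall>\<theta>. diagonalizable (p \<theta>)"
    and bnd: "\<exists>\<delta> > 0. \<forall>\<theta> \<in> {0..<2 * pi} - singular_angles f.
           norm1_mat (inv_sqrt (f \<theta>) * mat_adjoint (p (\<theta> + pi))) < \<delta>"
    and pd: "\<forall>\<theta> \<in> {0..<2 * pi}.
           pos_definite (mat_adjoint (p \<theta>) * p \<theta> + mat_adjoint (p (\<theta> + pi)) * p (\<theta> + pi))"
    and comm: "\<forall>\<theta> \<in> {0..<2 * pi}. p \<theta> * p (\<theta> + pi) = p (\<theta> + pi) * p \<theta>"
  shows "\<exists>\<gamma> > 0. \<forall>\<theta> \<in> {0..<2 * pi}. \<forall>x \<in> carrier_vec d. \<forall>y \<in> carrier_vec d. \<exists>w \<in> carrier_vec d.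
      mat_adjoint (p \<theta>) *\<^sub>v (x - p \<theta> *\<^sub>v w) + mat_adjoint (p (\<theta> + pi)) *\<^sub>v (y - p (\<theta> + pi) *\<^sub>v w) = 0\<^sub>v d \<and>
      (norm2_vec (x - p \<theta> *\<^sub>v w))\<^sup>2 + (norm2_vec (y - p (\<theta> + pi) *\<^sub>v w))\<^sup>2
        \<le> \<gamma> * (quad_form (f \<theta>) x + quad_form (f (\<theta> + pi)) y)"
proof -
  note pc = trig_poly_carrier[OF p]
  have fin: "finite (singular_angles f)" by (rule finite_singular_angles[OF f opp])
  obtain \<delta> where \<delta>: "\<forall>\<theta> \<in> {0..<2 * pi} - singular_angles f.
           norm1_mat (inv_sqrt (f \<theta>) * mat_adjoint (p (\<theta> + pi))) < \<delta>" using bnd by blast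
  define G where "G \<theta> = p \<theta> * mat_adjoint (p \<theta>) + p (\<theta> + pi) * mat_adjoint (p (\<theta> + pi))" for \<theta>
  have Gc: "G \<theta> \<in> carrier_mat d d" for \<theta> using pc[of \<theta>] pc[of "\<theta> + pi"] by (simp add: G_def)
  have G0: "det (G \<theta>) \<noteq> 0" for \<theta>
  proof -
    obtain \<theta>' m where \<theta>': "\<theta>' \<in> {0..<2*pi}" "\<theta> = \<theta>' + 2 * pi * of_int m" using angle_reduction by blast
    have "p (\<theta> + pi) = p (\<theta>' + pi)" "p \<theta> = p \<theta>'"
      using trig_poly_periodic[OF p, of "\<theta>' + pi" m] trig_poly_periodic[OF p, of \<theta>' m]
      by (simp_all add: \<theta>'(2) algebra_simps)
    then show ?thesis unfolding G_def
      using row_gram_det_nonzero[OF pc pc] comm pd diag \<theta>'(1) by simp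
  qed
  \<comment> \<open>Bounds uniform in \<theta> are wanted, so \<open>T\<close> is built as a
    continuous function on the whole line; compactness of [0, 2 pi] then bounds the products that
    occur in the residual.\<close>
  define T where "T \<theta> = inverse (det (G \<theta>)) \<cdot>\<^sub>m adj_mat (G \<theta>)" for \<theta>
  note pe = entries_continuous_trig_poly[OF p]
  have Ge: "entries_continuous d G" unfolding G_def
    by (intro entries_continuous_add entries_continuous_mult entries_continuous_adjoint entries_continuous_shift[OF pe] pe)
  have Te: "entries_continuous d T" unfolding T_def by (rule entries_continuous_inverse[OF Ge G0])
  have "entries_continuous d (\<lambda>\<theta>. mat_adjoint (p \<theta>) * T \<theta>)"
    by (intro entries_continuous_mult entries_continuous_adjoint pe Te)
  from entries_bounded[OF this] obtain c1 where
    c1: "\<And>\<theta> i j. \<theta> \<in> {0..2*pi} \<Longrightarrow> i < d \<Longrightarrow> j < d \<Longrightarrow> cmod ((mat_adjoint (p \<theta>) * T \<theta>) $$ (i,j)) \<le> c1" by blast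
  have "entries_continuous d (\<lambda>\<theta>. mat_adjoint (p (\<theta> + pi)) * T \<theta>)"
    by (intro entries_continuous_mult entries_continuous_adjoint entries_continuous_shift[OF pe] Te)
  from entries_bounded[OF this] obtain c2 where
    c2: "\<And>\<theta> i j. \<theta> \<in> {0..2*pi} \<Longrightarrow> i < d \<Longrightarrow> j < d \<Longrightarrow> cmod ((mat_adjoint (p (\<theta> + pi)) * T \<theta>) $$ (i,j)) \<le> c2" by blast
  define c where "c = max c1 c2"
  \<comment> \<open>The first factor comes from \<open>commuting_pair_least_squares\<close>, the
    second from \<open>norm2_shifted_symbol_le\<close>.\<close>
  define K where "K = 4 * (real d * real d * c\<^sup>2) * (real d * real d * \<delta>\<^sup>2)"
  have "K \<ge> 0" by (simp add: K_def)
  have nq: "quad_form (f \<theta>) v \<ge> 0" if "v \<in> carrier_vec d" for \<theta> v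
    using nn trig_poly_carrier[OF f, of \<theta>] that by (auto simp: nonneg_definite_def)
  show ?thesis
  \<comment> \<open>The summand 1 guarantees positivity, as \<open>K\<close> may be 0; the bound
    only grows, since the quadratic forms are nonnegative.\<close>
  proof (intro exI[of _ "K + 1"] conjI ballI)
    show "K + 1 > 0" using \<open>K \<ge> 0\<close> by simp
    fix \<theta> and x y :: "complex vec" assume \<theta>: "\<theta> \<in> {0..<2*pi}" and x: "x \<in> carrier_vec d" and y: "y \<in> carrier_vec d"
    define S where "S = mat_adjoint (p \<theta>) * p \<theta> + mat_adjoint (p (\<theta> + pi)) * p (\<theta> + pi)"
    have Sc: "S \<in> carrier_mat d d" using pc[of \<theta>] pc[of "\<theta> + pi"] by (simp add: S_def)
    have S0: "det S \<noteq> 0" by (rule pos_definite_det[OF Sc]) (use pd \<theta> in \<open>simp add: S_def\<close>)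
    \<comment> \<open>This inverse does not occur in the final bound, so it is taken separately at
      each angle.\<close>
    define Si where "Si = inverse (det S) \<cdot>\<^sub>m adj_mat S"
    note S = exists_inverse_of_det[OF Sc S0, folded Si_def]
    note T = exists_inverse_of_det[OF Gc[of \<theta>] G0, folded T_def]
    have PQ: "p \<theta> * p (\<theta> + pi) = p (\<theta> + pi) * p \<theta>" using comm \<theta> by blast
    have "\<exists>w \<in> carrier_vec d.
      mat_adjoint (p \<theta>) *\<^sub>v (x - p \<theta> *\<^sub>v w) + mat_adjoint (p (\<theta> + pi)) *\<^sub>v (y - p (\<theta> + pi) *\<^sub>v w) = 0\<^sub>v d \<and>
      (norm2_vec (x - p \<theta> *\<^sub>v w))\<^sup>2 + (norm2_vec (y - p (\<theta> + pi) *\<^sub>v w))\<^sup>2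
        \<le> 4 * (real d * real d * c\<^sup>2) * ((norm2_vec (p (\<theta> + pi) *\<^sub>v x))\<^sup>2 + (norm2_vec (p \<theta> *\<^sub>v y))\<^sup>2)"
      by (rule commuting_pair_least_squares[OF pc pc PQ S(1) S(3)[unfolded S_def] T(1) T(3)[unfolded G_def] _ _ x y])
         (use c1[of \<theta>] c2[of \<theta>] \<theta> in \<open>force simp: c_def\<close>)+
    then obtain w where w: "w \<in> carrier_vec d"
      "mat_adjoint (p \<theta>) *\<^sub>v (x - p \<theta> *\<^sub>v w) + mat_adjoint (p (\<theta> + pi)) *\<^sub>v (y - p (\<theta> + pi) *\<^sub>v w) = 0\<^sub>v d"
      and le: "(norm2_vec (x - p \<theta> *\<^sub>v w))\<^sup>2 + (norm2_vec (y - p (\<theta> + pi) *\<^sub>v w))\<^sup>2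
        \<le> 4 * (real d * real d * c\<^sup>2) * ((norm2_vec (p (\<theta> + pi) *\<^sub>v x))\<^sup>2 + (norm2_vec (p \<theta> *\<^sub>v y))\<^sup>2)" by blast
    note est = norm2_shifted_symbol_le[OF f nn fin p \<delta>]
    \<comment> \<open>The second term is the estimate at \<theta> + pi, where the shifted symbol is
      p(\<theta> + 2 pi) = p(\<theta>).\<close>
    have "(norm2_vec (p (\<theta> + pi) *\<^sub>v x))\<^sup>2 + (norm2_vec (p \<theta> *\<^sub>v y))\<^sup>2
        \<le> (real d * real d * \<delta>\<^sup>2) * (quad_form (f \<theta>) x + quad_form (f (\<theta> + pi)) y)"
      using est[OF x, of \<theta>] est[OF y, of "\<theta> + pi"] trig_poly_periodic_pi[OF p, of \<theta>]
      by (simp add: algebra_simps)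
    from mult_left_mono[OF this, of "4 * (real d * real d * c\<^sup>2)"]
    have "4 * (real d * real d * c\<^sup>2) * ((norm2_vec (p (\<theta> + pi) *\<^sub>v x))\<^sup>2 + (norm2_vec (p \<theta> *\<^sub>v y))\<^sup>2)
        \<le> K * (quad_form (f \<theta>) x + quad_form (f (\<theta> + pi)) y)"
      unfolding K_def by (simp only: mult.assoc) simp
    also have "\<dots> \<le> (K + 1) * (quad_form (f \<theta>) x + quad_form (f (\<theta> + pi)) y)"
      using nq[OF x, of \<theta>] nq[OF y, of "\<theta> + pi"] by (intro mult_right_mono) auto
    finally have le2: "(norm2_vec (x - p \<theta> *\<^sub>v w))\<^sup>2 + (norm2_vec (y - p (\<theta> + pi) *\<^sub>v w))\<^sup>2
        \<le> (K + 1) * (quad_form (f \<theta>) x + quad_form (f (\<theta> + pi)) y)" using le by linarith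
    show "\<exists>w \<in> carrier_vec d.
      mat_adjoint (p \<theta>) *\<^sub>v (x - p \<theta> *\<^sub>v w) + mat_adjoint (p (\<theta> + pi)) *\<^sub>v (y - p (\<theta> + pi) *\<^sub>v w) = 0\<^sub>v d \<and>
      (norm2_vec (x - p \<theta> *\<^sub>v w))\<^sup>2 + (norm2_vec (y - p (\<theta> + pi) *\<^sub>v w))\<^sup>2
        \<le> (K + 1) * (quad_form (f \<theta>) x + quad_form (f (\<theta> + pi)) y)"
      using w le2 by blast
  qed
qed

section \<open>Kronecker products and the block Fourier matrix\<close>

lemma index_in_block: "j < n \<Longrightarrow> a < d \<Longrightarrow> j * d + a < n * (d :: nat)"
proof -
  assume "j < n" "a < d"
  then have "j * d + a < Suc j * d" by simp
  also have "\<dots> \<le> n * d" using \<open>j < n\<close> by (intro mult_le_mono1) simp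
  finally show ?thesis .
qed

text \<open>An index x of a Kronecker product encodes the pair (x div d, x mod d) of a block and a
  position inside it. In the uses below the summand is written as an explicit function of this pair,
  to match \<open>h\<close>.\<close>

lemma sum_div_mod: "(\<Sum>x<n * d. h (x div d) (x mod d)) = (\<Sum>j<n. \<Sum>a<d. h j a)" for d :: nat
proof -
  have "(\<Sum>x<n * d. h (x div d) (x mod d)) = (\<Sum>j<n. \<Sum>x = j * d..<j * d + d. h (x div d) (x mod d))"
    by (rule sum.nat_group[symmetric])
  also have "\<dots> = (\<Sum>j<n. \<Sum>a<d. h j a)"
  proof (rule sum.cong[OF refl])
    fix j
    have "(\<Sum>x = j * d..<j * d + d. h (x div d) (x mod d)) = (\<Sum>a<d. h ((a + j * d) div d) ((a + j * d) mod d))"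
      using sum.shift_bounds_nat_ivl[of "\<lambda>x. h (x div d) (x mod d)" 0 "j * d" d]
      by (simp add: atLeast0LessThan add.commute)
    also have "\<dots> = (\<Sum>a<d. h j a)" by (intro sum.cong) auto
    finally show "(\<Sum>x = j * d..<j * d + d. h (x div d) (x mod d)) = (\<Sum>a<d. h j a)" .
  qed
  finally show ?thesis .
qed

lemma div_mod_less:
  assumes "x < n * (d :: nat)"
  shows "x div d < n" "x mod d < d"
proof -
  have "d > 0" using assms by (cases d) auto
  then show "x mod d < d" by simp
  show "x div d < n" using assms by (rule less_mult_imp_div_less)
qed

lemma kronecker_carrier:
  "A \<in> carrier_mat n m \<Longrightarrow> B \<in> carrier_mat p q \<Longrightarrow> kronecker A B \<in> carrier_mat (n * p) (m * q)"
  by (auto simp: kronecker_def)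

lemma kronecker_index:
  assumes "A \<in> carrier_mat n m" "B \<in> carrier_mat p q" "x < n * p" "y < m * q"
  shows "kronecker A B $$ (x,y) = A $$ (x div p, y div q) * B $$ (x mod p, y mod q)"
  using assms by (auto simp: kronecker_def)

lemma kronecker_mult:
  assumes A: "A \<in> carrier_mat n m" and B: "B \<in> carrier_mat p q" and C: "C \<in> carrier_mat m l" and D: "D \<in> carrier_mat q r"
  shows "kronecker A B * kronecker C D = kronecker (A * C) (B * D)"
proof (rule eq_matI)
  note K = kronecker_carrier[OF A B] kronecker_carrier[OF C D]
  have AC: "A * C \<in> carrier_mat n l" and BD: "B * D \<in> carrier_mat p r" using A B C D by auto
  note K' = kronecker_carrier[OF AC BD]
  fix x y assume "x < dim_row (kronecker (A * C) (B * D))" "y < dim_col (kronecker (A * C) (B * D))"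
  then have xy: "x < n * p" "y < l * r" using K' by auto
  note dm = div_mod_less[OF xy(1)] div_mod_less[OF xy(2)]
  have "(kronecker A B * kronecker C D) $$ (x,y) = (\<Sum>z<m * q. kronecker A B $$ (x,z) * kronecker C D $$ (z,y))"
    using K xy by (simp add: scalar_prod_def atLeast0LessThan)
  also have "\<dots> = (\<Sum>z<m * q. (\<lambda>j b. A $$ (x div p, j) * C $$ (j, y div r) * (B $$ (x mod p, b) * D $$ (b, y mod r))) (z div q) (z mod q))"
    using xy by (intro sum.cong) (auto simp: kronecker_index[OF A B] kronecker_index[OF C D])
  also have "\<dots> = (\<Sum>j<m. \<Sum>b<q. A $$ (x div p, j) * C $$ (j, y div r) * (B $$ (x mod p, b) * D $$ (b, y mod r)))"
    by (rule sum_div_mod)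
  also have "\<dots> = (\<Sum>j<m. A $$ (x div p, j) * C $$ (j, y div r)) * (\<Sum>b<q. B $$ (x mod p, b) * D $$ (b, y mod r))"
    by (simp add: sum_product)
  also have "\<dots> = (A * C) $$ (x div p, y div r) * (B * D) $$ (x mod p, y mod r)"
    using A B C D dm by (simp add: scalar_prod_def atLeast0LessThan)
  also have "\<dots> = kronecker (A * C) (B * D) $$ (x,y)" using kronecker_index[OF AC BD xy] by simp
  finally show "(kronecker A B * kronecker C D) $$ (x,y) = kronecker (A * C) (B * D) $$ (x,y)" .
qed (use A B C D in \<open>auto simp: kronecker_def\<close>)

lemma kronecker_adjoint:
  assumes A: "A \<in> carrier_mat n m" and B: "B \<in> carrier_mat p q"
  shows "mat_adjoint (kronecker A B) = kronecker (mat_adjoint A) (mat_adjoint B)"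
proof (rule eq_matI)
  note K = kronecker_carrier[OF A B] kronecker_carrier[OF mat_adjoint_carrier[OF A] mat_adjoint_carrier[OF B]]
  fix x y assume "x < dim_row (kronecker (mat_adjoint A) (mat_adjoint B))" "y < dim_col (kronecker (mat_adjoint A) (mat_adjoint B))"
  then have xy: "x < m * q" "y < n * p" using K by auto
  note dm = div_mod_less[OF xy(1)] div_mod_less[OF xy(2)]
  have "mat_adjoint (kronecker A B) $$ (x,y) = cnj (kronecker A B $$ (y,x))"
    by (rule mat_adjoint_index) (use K xy in auto)
  then show "mat_adjoint (kronecker A B) $$ (x,y) = kronecker (mat_adjoint A) (mat_adjoint B) $$ (x,y)"
    using A B dm xy by (simp add: kronecker_index[OF A B] kronecker_index[OF mat_adjoint_carrier[OF A] mat_adjoint_carrier[OF B]])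
qed (use A B in \<open>auto simp: kronecker_def\<close>)

lemma kronecker_one: "kronecker (1\<^sub>m n) (1\<^sub>m d) = 1\<^sub>m (n * d)"
proof (rule eq_matI)
  fix x y assume "x < dim_row (1\<^sub>m (n * d) :: complex mat)" "y < dim_col (1\<^sub>m (n * d) :: complex mat)"
  then have xy: "x < n * d" "y < n * d" by auto
  note dm = div_mod_less[OF xy(1)] div_mod_less[OF xy(2)]
  have "x = y \<longleftrightarrow> x div d = y div d \<and> x mod d = y mod d" by (metis div_mult_mod_eq)
  then show "kronecker (1\<^sub>m n) (1\<^sub>m d) $$ (x,y) = 1\<^sub>m (n * d) $$ (x,y)"
    using xy dm by (auto simp: kronecker_def)
qed (auto simp: kronecker_def)

section \<open>The Fourier matrix and its block version\<close>

lemma fourier_mat_carrier [simp]: "fourier_mat n \<in> carrier_mat n n"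
  by (simp add: fourier_mat_def)

lemma fourier_mat_index:
  "i < n \<Longrightarrow> j < n \<Longrightarrow> fourier_mat n $$ (i,j) = cis (- (2 * pi * real i * real j / real n)) / of_real (sqrt (real n))"
  by (auto simp: fourier_mat_def grid_point_def cis_conv_exp mult_ac)

text \<open>Entry (i, j) is the mean of n consecutive powers of \<omega>, an n-th root of unity that
  equals 1 only for i = j; otherwise the geometric sum is zero.\<close>

lemma fourier_mat_unitary:
  assumes n: "n > 0"
  shows "mat_adjoint (fourier_mat n) * fourier_mat n = 1\<^sub>m n"
proof (rule eq_matI)
  fix i j assume "i < dim_row (1\<^sub>m n :: complex mat)" "j < dim_col (1\<^sub>m n :: complex mat)"
  then have ij: "i < n" "j < n" by auto
  define \<omega> where "\<omega> = cis (2 * pi * (real i - real j) / real n)"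
  have F: "fourier_mat n \<in> carrier_mat n n" by simp
  have "(mat_adjoint (fourier_mat n) * fourier_mat n) $$ (i,j)
      = (\<Sum>k<n. cnj (fourier_mat n $$ (k,i)) * fourier_mat n $$ (k,j))"
    using F ij carrier_matD[OF F] by (simp add: scalar_prod_def atLeast0LessThan)
  also have "\<dots> = (\<Sum>k<n. \<omega> ^ k / of_nat n)"
  proof (rule sum.cong)
    fix k assume "k \<in> {..<n}"
    then have k: "k < n" by simp
    have "cnj (fourier_mat n $$ (k,i)) * fourier_mat n $$ (k,j)
        = cis (2 * pi * real k * real i / real n) * cis (- (2 * pi * real k * real j / real n)) / (of_real (sqrt (real n)) * of_real (sqrt (real n)))"
      using k ij by (simp add: fourier_mat_index cis_cnj)
    also have "complex_of_real (sqrt (real n)) * of_real (sqrt (real n)) = of_nat n"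
      by (simp add: of_real_mult[symmetric] del: of_real_mult)
    also have "cis (2 * pi * real k * real i / real n) * cis (- (2 * pi * real k * real j / real n)) = \<omega> ^ k"
      using n by (simp add: \<omega>_def DeMoivre cis_mult field_simps)
    finally show "cnj (fourier_mat n $$ (k,i)) * fourier_mat n $$ (k,j) = \<omega> ^ k / of_nat n" .
  qed simp
  also have "\<dots> = (\<Sum>k<n. \<omega> ^ k) / of_nat n" by (simp add: sum_divide_distrib)
  also have "\<dots> = 1\<^sub>m n $$ (i,j)"
  proof (cases "i = j")
    case True
    then have "\<omega> = 1" by (simp add: \<omega>_def)
    then show ?thesis using True ij n by simp
  next
    case False
    have "\<omega> ^ n = cis (2 * pi * of_int (int i - int j))"
      using n by (simp add: \<omega>_def DeMoivre)
    also have "\<dots> = 1" by (rule cis_multiple_2pi) simp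
    finally have 1: "\<omega> ^ n = 1" .
    have "\<omega> \<noteq> 1"
    proof
      assume "\<omega> = 1"
      have "cis (2 * pi * real i / real n) = \<omega> * cis (2 * pi * real j / real n)"
        by (simp add: \<omega>_def cis_mult diff_divide_distrib right_diff_distrib)
      then have "cis (2 * pi * real i / real n) = cis (2 * pi * real j / real n)" by (simp add: \<open>\<omega> = 1\<close>)
      then have "2 * pi * real i / real n = 2 * pi * real j / real n"
        by (rule inj_onD[OF inj_on_cis]) (use ij in \<open>auto simp: field_simps\<close>)
      then show False using False n by simp
    qed
    then have "(\<Sum>k<n. \<omega> ^ k) = 0" using 1 by (simp add: sum_gp_strict)
    then show ?thesis using False ij by simp
  qed
  finally show "(mat_adjoint (fourier_mat n) * fourier_mat n) $$ (i,j) = 1\<^sub>m n $$ (i,j)" .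
qed (auto simp: fourier_mat_def)

definition block_fourier :: "nat \<Rightarrow> nat \<Rightarrow> complex mat" where
  "block_fourier d n = kronecker (fourier_mat n) (1\<^sub>m d)"

lemma block_fourier_carrier [simp]: "block_fourier d n \<in> carrier_mat (n * d) (n * d)"
  unfolding block_fourier_def by (rule kronecker_carrier) simp_all

lemma block_fourier_adjoint: "mat_adjoint (block_fourier d n) = kronecker (mat_adjoint (fourier_mat n)) (1\<^sub>m d)"
  unfolding block_fourier_def by (subst kronecker_adjoint[of _ n n _ d d]) simp_all

lemma block_fourier_unitary:
  assumes "n > 0"
  shows "mat_adjoint (block_fourier d n) * block_fourier d n = 1\<^sub>m (n * d)"
    "block_fourier d n * mat_adjoint (block_fourier d n) = 1\<^sub>m (n * d)"
proof -
  show 1: "mat_adjoint (block_fourier d n) * block_fourier d n = 1\<^sub>m (n * d)"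
    unfolding block_fourier_adjoint unfolding block_fourier_def
    by (subst kronecker_mult[of _ n n _ d d _ n _ d]) (simp_all add: fourier_mat_unitary[OF assms] kronecker_one)
  show "block_fourier d n * mat_adjoint (block_fourier d n) = 1\<^sub>m (n * d)"
    by (rule mat_mult_left_right_inverse[OF _ _ 1]) simp_all
qed

section \<open>Block-diagonal matrices and blocks of vectors\<close>

lemma diag_block_mat_square:
  assumes "\<forall>A \<in> set As. A \<in> carrier_mat d d"
  shows "diag_block_mat As \<in> carrier_mat (length As * d) (length As * d)"
    "x < length As * d \<Longrightarrow> y < length As * d \<Longrightarrow>
      diag_block_mat As $$ (x,y) = (if x div d = y div d then (As ! (x div d)) $$ (x mod d, y mod d) else 0)"
  using assms
proof (induction As arbitrary: x y)
  case Nil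
  { case 1 then show ?case by simp next case 2 then show ?case by simp }
next
  case (Cons A As)
  { case 1
    then have "diag_block_mat As \<in> carrier_mat (length As * d) (length As * d)" "A \<in> carrier_mat d d"
      using Cons by auto
    then show ?case by (simp add: Let_def) }
  { case 2
    then have c: "diag_block_mat As \<in> carrier_mat (length As * d) (length As * d)" "A \<in> carrier_mat d d"
      using Cons by auto
    have d: "d > 0" using 2 by (cases d) auto
    \<comment> \<open>Removing the first block lowers both indices by d, that is, the quotients by
      one, and keeps the remainders.\<close>
    have IH: "diag_block_mat As $$ (x - d, y - d) = (if (x - d) div d = (y - d) div d
        then (As ! ((x - d) div d)) $$ ((x - d) mod d, (y - d) mod d) else 0)" if "x \<ge> d" "y \<ge> d"
      by (rule Cons.IH(2)) (use that 2 in auto)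
    show ?case using c d 2 IH
      by (cases "x < d"; cases "y < d") (auto simp: Let_def le_div_geq le_mod_geq not_less)
  }
qed

text \<open>For a vector in the Fourier basis, block j is the amplitude at
  \<open>grid_point n j\<close>; in the original basis it is the d-component value at position
  j.\<close>

definition vec_block :: "nat \<Rightarrow> nat \<Rightarrow> complex vec \<Rightarrow> complex vec" where
  "vec_block d j v = vec d (\<lambda>a. v $ (j * d + a))"

lemma vec_block_carrier [simp]: "vec_block d j v \<in> carrier_vec d"
  by (simp add: vec_block_def)

lemma vec_block_dim [simp]: "dim_vec (vec_block d j v) = d"
  by (simp add: vec_block_def)

lemma vec_block_index [simp]: "a < d \<Longrightarrow> vec_block d j v $ a = v $ (j * d + a)"
  by (simp add: vec_block_def)

lemma vec_block_minus:
  assumes "v \<in> carrier_vec (n * d)" "j < n"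
  shows "vec_block d j (u - v) = vec_block d j u - vec_block d j v"
  using assms index_in_block[of j n _ d] by (intro eq_vecI) auto

lemma vec_block_eqI:
  assumes u: "u \<in> carrier_vec (n * d)" and v: "v \<in> carrier_vec (n * d)" and eq: "\<And>j. j < n \<Longrightarrow> vec_block d j u = vec_block d j v"
  shows "u = v"
proof (rule eq_vecI)
  fix x assume "x < dim_vec v"
  then have x: "x < n * d" using v by simp
  note dm = div_mod_less[OF x]
  have "u $ (x div d * d + x mod d) = v $ (x div d * d + x mod d)"
    using arg_cong[OF eq[OF dm(1)], of "\<lambda>w. w $ (x mod d)"] dm(2) by simp
  then show "u $ x = v $ x" by simp
qed (use u v in auto)

lemma cscalar_prod_blocks:
  assumes "u \<in> carrier_vec (n * d)" "v \<in> carrier_vec (n * d)"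
  shows "u \<bullet>c v = (\<Sum>j<n. vec_block d j u \<bullet>c vec_block d j v)"
proof -
  have "u \<bullet>c v = (\<Sum>x<n * d. (\<lambda>j a. u $ (j * d + a) * cnj (v $ (j * d + a))) (x div d) (x mod d))"
    using assms by (simp add: cscalar_prod_sum)
  also have "\<dots> = (\<Sum>j<n. \<Sum>a<d. u $ (j * d + a) * cnj (v $ (j * d + a)))" by (rule sum_div_mod)
  finally show ?thesis by (simp add: cscalar_prod_sum)
qed

lemma norm2_vec_blocks:
  assumes "v \<in> carrier_vec (n * d)"
  shows "(norm2_vec v)\<^sup>2 = (\<Sum>j<n. (norm2_vec (vec_block d j v))\<^sup>2)"
  by (simp add: norm2_vec_cscalar_Re cscalar_prod_blocks[OF assms assms])

lemma mult_kronecker_one_block: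
  assumes A: "A \<in> carrier_mat n m" and v: "v \<in> carrier_vec (m * d)" and i: "i < n" and a: "a < d"
  shows "(kronecker A (1\<^sub>m d) *\<^sub>v v) $ (i * d + a) = (\<Sum>j<m. A $$ (i,j) * v $ (j * d + a))"
proof -
  have K: "kronecker A (1\<^sub>m d) \<in> carrier_mat (n * d) (m * d)" by (rule kronecker_carrier[OF A]) simp
  have x: "i * d + a < n * d" by (rule index_in_block[OF i a])
  have "(kronecker A (1\<^sub>m d) *\<^sub>v v) $ (i * d + a) = (\<Sum>z<m * d. kronecker A (1\<^sub>m d) $$ (i * d + a, z) * v $ z)"
    using K v x by (simp add: scalar_prod_def atLeast0LessThan)
  also have "\<dots> = (\<Sum>z<m * d. (\<lambda>j b. A $$ (i,j) * (1\<^sub>m d $$ (a,b)) * v $ (j * d + b)) (z div d) (z mod d))"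
    using a x by (intro sum.cong) (auto simp: kronecker_index[OF A, of "1\<^sub>m d" d d])
  also have "\<dots> = (\<Sum>j<m. \<Sum>b<d. A $$ (i,j) * (1\<^sub>m d $$ (a,b)) * v $ (j * d + b))" by (rule sum_div_mod)
  also have "\<dots> = (\<Sum>j<m. \<Sum>b<d. if b = a then A $$ (i,j) * v $ (j * d + a) else 0)"
    using a by (intro sum.cong) auto
  also have "\<dots> = (\<Sum>j<m. A $$ (i,j) * v $ (j * d + a))" using a by simp
  finally show ?thesis .
qed

lemma diag_block_mat_mult_vec:
  assumes G: "\<And>j. j < n \<Longrightarrow> G j \<in> carrier_mat d d" and v: "v \<in> carrier_vec (n * d)" and j: "j < n"
  shows "vec_block d j (diag_block_mat (map G [0..<n]) *\<^sub>v v) = G j *\<^sub>v vec_block d j v"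
proof (rule eq_vecI)
  let ?D = "diag_block_mat (map G [0..<n])"
  have all: "\<forall>A \<in> set (map G [0..<n]). A \<in> carrier_mat d d" using G by auto
  note D = diag_block_mat_square[OF all, simplified]
  fix a assume "a < dim_vec (G j *\<^sub>v vec_block d j v)"
  then have a: "a < d" using G[OF j] by simp
  note x = index_in_block[OF j a]
  have "vec_block d j (?D *\<^sub>v v) $ a = (\<Sum>z<n * d. ?D $$ (j * d + a, z) * v $ z)"
    using D(1) v x a by (simp add: scalar_prod_def atLeast0LessThan)
  also have "\<dots> = (\<Sum>z<n * d. (\<lambda>k b. if k = j then G j $$ (a,b) * v $ (j * d + b) else 0) (z div d) (z mod d))"
  proof (intro sum.cong refl)
    fix z assume "z \<in> {..<n * d}"
    then have z: "z < n * d" by simp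
    note dm = div_mod_less[OF z]
    have "v $ z = v $ (z div d * d + z mod d)" by simp
    then show "?D $$ (j * d + a, z) * v $ z
      = (\<lambda>k b. if k = j then G j $$ (a,b) * v $ (j * d + b) else 0) (z div d) (z mod d)"
      using D(2)[OF x z] a j dm by auto
  qed
  also have "\<dots> = (\<Sum>k<n. \<Sum>b<d. if k = j then G j $$ (a,b) * v $ (j * d + b) else 0)" by (rule sum_div_mod)
  also have "\<dots> = (\<Sum>k<n. if k = j then \<Sum>b<d. G j $$ (a,b) * v $ (j * d + b) else 0)"
    by (intro sum.cong) auto
  also have "\<dots> = (\<Sum>b<d. G j $$ (a,b) * v $ (j * d + b))" using j by simp
  also have "\<dots> = (G j *\<^sub>v vec_block d j v) $ a"
    using G[OF j] a by (simp add: scalar_prod_def atLeast0LessThan)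
  finally show "vec_block d j (?D *\<^sub>v v) $ a = (G j *\<^sub>v vec_block d j v) $ a" .
qed (use G[OF j] in auto)

lemma diag_block_mat_adjoint:
  fixes G :: "nat \<Rightarrow> complex mat"
  assumes G: "\<And>j. j < n \<Longrightarrow> G j \<in> carrier_mat d d"
  shows "mat_adjoint (diag_block_mat (map G [0..<n])) = diag_block_mat (map (\<lambda>j. mat_adjoint (G j)) [0..<n])"
proof (rule eq_matI)
  let ?D = "diag_block_mat (map G [0..<n])" and ?D' = "diag_block_mat (map (\<lambda>j. mat_adjoint (G j)) [0..<n])"
  have all: "\<forall>A \<in> set (map G [0..<n]). A \<in> carrier_mat d d"
    and all': "\<forall>A \<in> set (map (\<lambda>j. mat_adjoint (G j)) [0..<n]). A \<in> carrier_mat d d" using G by auto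
  note D = diag_block_mat_square[OF all, simplified] and D' = diag_block_mat_square[OF all', simplified]
  show "dim_row (mat_adjoint ?D) = dim_row ?D'" "dim_col (mat_adjoint ?D) = dim_col ?D'"
    using D(1) D'(1) by auto
  fix x y assume "x < dim_row ?D'" "y < dim_col ?D'"
  then have xy: "x < n * d" "y < n * d" using D'(1) by auto
  note dm = div_mod_less[OF xy(1)] div_mod_less[OF xy(2)]
  have "mat_adjoint ?D $$ (x,y) = cnj (?D $$ (y,x))" by (rule mat_adjoint_index) (use D(1) xy in auto)
  then show "mat_adjoint ?D $$ (x,y) = ?D' $$ (x,y)"
    using G[OF dm(1)] dm D(2)[OF xy(2,1)] D'(2)[OF xy] by auto
qed

section \<open>From frequencies to the two-grid operator\<close>

text \<open>Frequencies j and j + k agree at even positions and differ by a sign at odd ones. This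
  is the aliasing that couples \<theta> and \<theta> + pi.\<close>

lemma fourier_mat_half_shift:
  assumes "n = 2 * k" "i < n" "j < k"
  shows "fourier_mat n $$ (i, j + k) = (-1) ^ i * fourier_mat n $$ (i,j)"
proof -
  have k: "real k > 0" using assms by simp
  have "2 * pi * real i * real (j + k) / real n = 2 * pi * real i * real j / real n + real i * pi"
    using assms k by (simp add: field_simps)
  then have "cis (- (2 * pi * real i * real (j + k) / real n))
      = cis (- (2 * pi * real i * real j / real n)) * cis (- (real i * pi))"
    by (simp add: cis_mult)
  also have "cis (- (real i * pi)) = (-1) ^ i"
  proof -
    have "cis (- (real i * pi)) = cis (real i * (- pi))" by simp
    also have "\<dots> = cis (- pi) ^ i" by (simp only: DeMoivre)
    finally show ?thesis by (simp add: cis.ctr complex_eq_iff)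
  qed
  finally show ?thesis using assms by (simp add: fourier_mat_index)
qed

lemma sum_half_split:
  fixes h :: "nat \<Rightarrow> 'a::comm_monoid_add"
  shows "(\<Sum>j<2 * k. h j) = (\<Sum>j<k. h j + h (j + k))"
proof -
  have "{..<2 * k} = {..<k} \<union> {k..<k + k}" by auto
  then have "(\<Sum>j<2 * k. h j) = (\<Sum>j<k. h j) + (\<Sum>j = k..<k + k. h j)"
    by (simp add: sum.union_disjoint ivl_disj_int)
  then show ?thesis using sum.shift_bounds_nat_ivl[of h 0 k k]
    by (simp add: atLeast0LessThan sum.distrib)
qed

text \<open>Frequencies j and j + k contribute with the common factor 1 + s (-1)^i. For s = 1 it
  vanishes at odd positions, for s = -1 at even ones; the first case yields a preimage under
  upsampling, the second orthogonality.\<close>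

lemma block_fourier_parity:
  assumes n: "n = 2 * k" and w: "w \<in> carrier_vec (n * d)"
    and per: "\<And>j. j < k \<Longrightarrow> vec_block d (j + k) w = s \<cdot>\<^sub>v vec_block d j w"
    and i: "i < n" and s: "1 + s * (-1) ^ i = 0"
  shows "vec_block d i (block_fourier d n *\<^sub>v w) = 0\<^sub>v d"
proof (rule eq_vecI)
  fix a assume "a < dim_vec (0\<^sub>v d :: complex vec)"
  then have a: "a < d" by simp
  have "vec_block d i (block_fourier d n *\<^sub>v w) $ a = (\<Sum>j<2 * k. fourier_mat n $$ (i,j) * w $ (j * d + a))"
    using mult_kronecker_one_block[OF fourier_mat_carrier w i a] a by (simp add: block_fourier_def n)
  also have "\<dots> = (\<Sum>j<k. fourier_mat n $$ (i,j) * w $ (j * d + a))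
      + (\<Sum>j<k. fourier_mat n $$ (i,j + k) * w $ ((j + k) * d + a))"
    unfolding sum_half_split sum.distrib ..
  also have "\<dots> = (\<Sum>j<k. (1 + s * (-1) ^ i) * (fourier_mat n $$ (i,j) * w $ (j * d + a)))"
  proof -
    have "fourier_mat n $$ (i,j + k) * w $ ((j + k) * d + a) = s * (-1) ^ i * (fourier_mat n $$ (i,j) * w $ (j * d + a))"
      if j: "j < k" for j
    proof -
      have "w $ ((j + k) * d + a) = s * w $ (j * d + a)"
        using arg_cong[OF per[OF j], of "\<lambda>v. v $ a"] a by simp
      then show ?thesis using fourier_mat_half_shift[OF n i j] by simp
    qed
    then have "(\<Sum>j<k. fourier_mat n $$ (i,j + k) * w $ ((j + k) * d + a))
        = (\<Sum>j<k. s * (-1) ^ i * (fourier_mat n $$ (i,j) * w $ (j * d + a)))"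
      by (intro sum.cong) auto
    then show ?thesis
      by (simp only: sum.distrib[symmetric] distrib_right[of 1] mult_1_left)
  qed
  also have "\<dots> = 0" by (simp add: s)
  finally show "vec_block d i (block_fourier d n *\<^sub>v w) $ a = 0\<^sub>v d $ a" using a by simp
qed simp

lemma norm2_block_fourier:
  assumes "n > 0" and w: "w \<in> carrier_vec (n * d)"
  shows "(norm2_vec (block_fourier d n *\<^sub>v w))\<^sup>2 = (norm2_vec w)\<^sup>2"
  using quad_form_adjoint_mult[OF block_fourier_carrier w] w
  by (simp add: block_fourier_unitary[OF assms(1)] quad_form_def norm2_vec_cscalar_Re)

section \<open>Block-circulant matrices in the Fourier basis\<close>

definition symbol_mat :: "nat \<Rightarrow> (real \<Rightarrow> complex mat) \<Rightarrow> complex mat" where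
  "symbol_mat n g = diag_block_mat (map (\<lambda>i. g (grid_point n i)) [0..<n])"

lemma block_circulant_eq:
  "block_circulant d n g = block_fourier d n * symbol_mat n g * mat_adjoint (block_fourier d n)"
  by (simp add: block_circulant_def block_fourier_adjoint symbol_mat_def) (simp add: block_fourier_def)

lemma symbol_mat_carrier:
  assumes "\<And>\<theta>. g \<theta> \<in> carrier_mat d d"
  shows "symbol_mat n g \<in> carrier_mat (n * d) (n * d)"
  unfolding symbol_mat_def
  using diag_block_mat_square(1)[of "map (\<lambda>i. g (grid_point n i)) [0..<n]" d] assms by auto

lemma symbol_mat_block:
  assumes "\<And>\<theta>. g \<theta> \<in> carrier_mat d d" "v \<in> carrier_vec (n * d)" "j < n"
  shows "vec_block d j (symbol_mat n g *\<^sub>v v) = g (grid_point n j) *\<^sub>v vec_block d j v"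
  unfolding symbol_mat_def using assms by (intro diag_block_mat_mult_vec) auto

lemma symbol_mat_adjoint:
  assumes "\<And>\<theta>. g \<theta> \<in> carrier_mat d d"
  shows "mat_adjoint (symbol_mat n g) = symbol_mat n (\<lambda>\<theta>. mat_adjoint (g \<theta>))"
  unfolding symbol_mat_def using assms by (intro diag_block_mat_adjoint[of _ _ d]) auto

text \<open>Moving the left Fourier factor to the other argument of the inner product leaves a
  block-diagonal form, which splits over the grid points.\<close>

lemma quad_form_block_circulant:
  assumes n: "n > 0" and f: "\<And>\<theta>. f \<theta> \<in> carrier_mat d d" and x: "x \<in> carrier_vec (n * d)"
  shows "quad_form (block_circulant d n f) x
    = (\<Sum>j<n. quad_form (f (grid_point n j)) (vec_block d j (mat_adjoint (block_fourier d n) *\<^sub>v x)))"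
proof -
  define U where "U = block_fourier d n"
  define B where "B = symbol_mat n f"
  have c: "U \<in> carrier_mat (n * d) (n * d)" "B \<in> carrier_mat (n * d) (n * d)"
    using symbol_mat_carrier[of f d n] f by (auto simp: U_def B_def)
  define h where "h = mat_adjoint U *\<^sub>v x"
  have h: "h \<in> carrier_vec (n * d)" using c by (auto simp: h_def intro!: carrier_vecI)
  have Bh: "B *\<^sub>v h \<in> carrier_vec (n * d)" using c by (auto intro!: carrier_vecI)
  have "(block_circulant d n f *\<^sub>v x) \<bullet>c x = (U *\<^sub>v (B *\<^sub>v h)) \<bullet>c x"
    using c x h by (simp add: block_circulant_eq U_def[symmetric] B_def[symmetric] h_def
        assoc_mult_mat_vec[of _ "n * d" "n * d" _ "n * d"])
  also have "\<dots> = (B *\<^sub>v h) \<bullet>c h" using cscalar_prod_adjoint[OF c(1) Bh x] by (simp add: h_def)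
  also have "\<dots> = (\<Sum>j<n. (f (grid_point n j) *\<^sub>v vec_block d j h) \<bullet>c vec_block d j h)"
    unfolding cscalar_prod_blocks[OF Bh h]
    by (intro sum.cong refl) (simp add: B_def symbol_mat_block[OF f h])
  finally show ?thesis by (simp add: quad_form_def h_def U_def)
qed

section \<open>Upsampling and the gluing of local minimisers\<close>

definition upsampling :: "nat \<Rightarrow> nat \<Rightarrow> complex mat" where
  "upsampling d n = kronecker (transpose_mat (cutting_mat n)) (1\<^sub>m d)"

lemma upsampling_carrier: "upsampling d n \<in> carrier_mat (n * d) (n div 2 * d)"
  unfolding upsampling_def by (rule kronecker_carrier) (auto simp: cutting_mat_def)

lemma upsampling_block:
  assumes n: "n = 2 * k" and y: "y \<in> carrier_vec (k * d)" and i: "i < n"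
  shows "vec_block d i (upsampling d n *\<^sub>v y) = (if even i then vec_block d (i div 2) y else 0\<^sub>v d)"
proof (rule eq_vecI)
  fix a assume "a < dim_vec (if even i then vec_block d (i div 2) y else 0\<^sub>v d)"
  then have a: "a < d" by (auto split: if_splits)
  have K: "transpose_mat (cutting_mat n) \<in> carrier_mat n k" by (auto simp: cutting_mat_def n)
  have "vec_block d i (upsampling d n *\<^sub>v y) $ a = (\<Sum>j<k. transpose_mat (cutting_mat n) $$ (i,j) * y $ (j * d + a))"
    using mult_kronecker_one_block[OF K y i a] a by (simp add: upsampling_def)
  also have "\<dots> = (\<Sum>j<k. if even i \<and> j = i div 2 then y $ (i div 2 * d + a) else 0)"
    using i by (intro sum.cong) (auto simp: cutting_mat_def n)
  also have "\<dots> = (if even i then y $ (i div 2 * d + a) else 0)"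
    using i n by (cases "even i") auto
  finally show "vec_block d i (upsampling d n *\<^sub>v y) $ a = (if even i then vec_block d (i div 2) y else 0\<^sub>v d) $ a"
    using a by simp
qed (auto simp: vec_block_def)

lemma grid_point_half_shift: "n = 2 * k \<Longrightarrow> k > 0 \<Longrightarrow> grid_point n (j + k) = grid_point n j + pi"
  by (simp add: grid_point_def field_simps)

lemma grid_point_mem: "j < n \<Longrightarrow> grid_point n j \<in> {0..<2 * pi}"
  by (simp add: grid_point_def field_simps)

lemma vec_block_of_blocks:
  assumes "j < n" "W j \<in> carrier_vec d"
  shows "vec_block d j (vec (n * d) (\<lambda>x. W (x div d) $ (x mod d))) = W j"
  using assms index_in_block[OF assms(1)] by (intro eq_vecI) auto

text \<open>The local solutions at the k pairs of opposite frequencies are glued. It remains to see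
  that the glued vector comes from some y and that the local normal equations give a global minimum;
  both rest on \<open>block_fourier_parity\<close>.\<close>

lemma two_grid_approximation:
  assumes k: "k > 0" and n: "n = 2 * k"
    and f: "\<And>\<theta>. f \<theta> \<in> carrier_mat d d" and p: "\<And>\<theta>. p \<theta> \<in> carrier_mat d d"
    and loc: "\<forall>\<theta> \<in> {0..<2 * pi}. \<forall>x \<in> carrier_vec d. \<forall>y \<in> carrier_vec d. \<exists>w \<in> carrier_vec d.
      mat_adjoint (p \<theta>) *\<^sub>v (x - p \<theta> *\<^sub>v w) + mat_adjoint (p (\<theta> + pi)) *\<^sub>v (y - p (\<theta> + pi) *\<^sub>v w) = 0\<^sub>v d \<and>
      (norm2_vec (x - p \<theta> *\<^sub>v w))\<^sup>2 + (norm2_vec (y - p (\<theta> + pi) *\<^sub>v w))\<^sup>2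
        \<le> \<gamma> * (quad_form (f \<theta>) x + quad_form (f (\<theta> + pi)) y)"
    and x: "x \<in> carrier_vec (n * d)"
  shows "\<exists>y. is_arg_min (\<lambda>y. (norm2_vec (x - prolongation d n p *\<^sub>v y))\<^sup>2) (\<lambda>y. y \<in> carrier_vec (k * d)) y \<and>
      (norm2_vec (x - prolongation d n p *\<^sub>v y))\<^sup>2 \<le> \<gamma> * quad_form (block_circulant d n f) x"
proof -
  have n0: "n > 0" using k n by simp
  define U where "U = block_fourier d n"
  define B where "B = symbol_mat n p"
  define K where "K = upsampling d n"
  define x' where "x' = mat_adjoint U *\<^sub>v x"
  define \<theta> where "\<theta> = grid_point n"
  let ?b = "vec_block d"
  have U: "U \<in> carrier_mat (n * d) (n * d)" and U': "mat_adjoint U \<in> carrier_mat (n * d) (n * d)"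
    by (auto simp: U_def)
  have B: "B \<in> carrier_mat (n * d) (n * d)" and B': "mat_adjoint B \<in> carrier_mat (n * d) (n * d)"
    using symbol_mat_carrier[OF p, of n] by (auto simp: B_def)
  have K: "K \<in> carrier_mat (n * d) (k * d)" using upsampling_carrier[of d n] by (simp add: K_def n)
  note UU = block_fourier_unitary[OF n0, of d, folded U_def]
  have mc: "A *\<^sub>v v \<in> carrier_vec (n * d)" if "A \<in> carrier_mat (n * d) m" for A and v :: "complex vec" and m
    using that by (intro carrier_vecI) auto
  have x': "x' \<in> carrier_vec (n * d)" unfolding x'_def by (rule mc[OF U'])
  have Bb: "?b j (B *\<^sub>v v) = p (\<theta> j) *\<^sub>v ?b j v" if "v \<in> carrier_vec (n * d)" "j < n" for j v
    unfolding B_def \<theta>_def by (rule symbol_mat_block[OF p that])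
  have B'b: "?b j (mat_adjoint B *\<^sub>v v) = mat_adjoint (p (\<theta> j)) *\<^sub>v ?b j v" if "v \<in> carrier_vec (n * d)" "j < n" for j v
    unfolding B_def \<theta>_def symbol_mat_adjoint[OF p] by (rule symbol_mat_block[OF _ that]) (use p in auto)
  have shift: "\<theta> (j + k) = \<theta> j + pi" for j unfolding \<theta>_def by (rule grid_point_half_shift[OF n k])
  define good where "good j w \<longleftrightarrow> w \<in> carrier_vec d \<and>
      mat_adjoint (p (\<theta> j)) *\<^sub>v (?b j x' - p (\<theta> j) *\<^sub>v w)
        + mat_adjoint (p (\<theta> (j + k))) *\<^sub>v (?b (j + k) x' - p (\<theta> (j + k)) *\<^sub>v w) = 0\<^sub>v d \<and>
      (norm2_vec (?b j x' - p (\<theta> j) *\<^sub>v w))\<^sup>2 + (norm2_vec (?b (j + k) x' - p (\<theta> (j + k)) *\<^sub>v w))\<^sup>2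
        \<le> \<gamma> * (quad_form (f (\<theta> j)) (?b j x') + quad_form (f (\<theta> (j + k))) (?b (j + k) x'))" for j w
  have "\<exists>w. good j w" if j: "j < k" for j
  proof -
    have "\<theta> j \<in> {0..<2 * pi}" unfolding \<theta>_def by (rule grid_point_mem) (use j n in simp)
    then show ?thesis using loc unfolding good_def shift by (meson vec_block_carrier)
  qed
  then obtain W where W: "\<And>j. j < k \<Longrightarrow> good j (W j)" by metis
  have Wc: "W (j mod k) \<in> carrier_vec d" for j using W[of "j mod k"] k by (simp add: good_def)
  \<comment> \<open>Reduction mod k repeats \<open>W j\<close> at the frequency j + k: this is the
    periodicity that upsampled vectors have in the Fourier basis.\<close>
  define w where "w = vec (n * d) (\<lambda>z. W ((z div d) mod k) $ (z mod d))"
  have w: "w \<in> carrier_vec (n * d)" by (simp add: w_def)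
  have wb: "?b j w = W (j mod k)" if "j < n" for j
    unfolding w_def by (rule vec_block_of_blocks[OF that Wc])
  define r where "r = x' - B *\<^sub>v w"
  have r: "r \<in> carrier_vec (n * d)" unfolding r_def using mc[OF B] by (rule minus_carrier_vec[OF x'])
  have rb: "?b j r = ?b j x' - p (\<theta> j) *\<^sub>v W (j mod k)" if j: "j < n" for j
    unfolding r_def vec_block_minus[OF mc[OF B] j] Bb[OF w j] wb[OF j] ..
  \<comment> \<open>\<open>U *\<^sub>v w\<close> vanishes at odd positions, so its even blocks form
    a preimage under upsampling.\<close>
  define y where "y = vec (k * d) (\<lambda>z. (U *\<^sub>v w) $ (2 * (z div d) * d + z mod d))"
  have y: "y \<in> carrier_vec (k * d)" by (simp add: y_def)
  have Ky: "K *\<^sub>v y = U *\<^sub>v w"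
  proof (rule vec_block_eqI[OF mc[OF K] mc[OF U]])
    fix i assume i: "i < n"
    show "?b i (K *\<^sub>v y) = ?b i (U *\<^sub>v w)"
    proof (cases "even i")
      case True
      have "i div 2 < k" using i n by auto
      then have "?b (i div 2) y = ?b i (U *\<^sub>v w)"
        using True index_in_block[of "i div 2" k _ d] by (intro eq_vecI) (auto simp: y_def)
      then show ?thesis using True upsampling_block[OF n y i] by (simp add: K_def)
    next
      case False
      have "?b i (U *\<^sub>v w) = 0\<^sub>v d" unfolding U_def
      proof (rule block_fourier_parity[OF n w _ i, of 1])
        show "?b (j + k) w = 1 \<cdot>\<^sub>v ?b j w" if "j < k" for j using that n by (simp add: wb)
      qed (use False in simp)
      then show ?thesis using False upsampling_block[OF n y i] by (simp add: K_def)
    qed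
  qed
  have P: "prolongation d n p = U * B * mat_adjoint U * K"
    by (simp add: prolongation_def block_circulant_eq U_def B_def K_def upsampling_def)
  have Pv: "prolongation d n p *\<^sub>v v = U *\<^sub>v (B *\<^sub>v (mat_adjoint U *\<^sub>v (K *\<^sub>v v)))" if "v \<in> carrier_vec (k * d)" for v
    unfolding P using U U' B K that mc
    by (simp add: assoc_mult_mat_vec[of _ "n * d" "n * d" _ "k * d"] assoc_mult_mat_vec[of _ "n * d" "n * d" _ "n * d"] mc[OF K] mc[OF U'])
  have Pc: "prolongation d n p \<in> carrier_mat (n * d) (k * d)" unfolding P using U U' B K
    by (intro mult_carrier_mat[of _ _ "n * d"]) auto
  have res: "x - prolongation d n p *\<^sub>v y = U *\<^sub>v r"
  proof -
    have "mat_adjoint U *\<^sub>v (U *\<^sub>v w) = w"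
      using assoc_mult_mat_vec[OF U' U w] UU w by simp
    then have "prolongation d n p *\<^sub>v y = U *\<^sub>v (B *\<^sub>v w)" using Pv[OF y] by (simp add: Ky)
    moreover have "x = U *\<^sub>v x'" using assoc_mult_mat_vec[OF U U' x] UU x by (simp add: x'_def)
    ultimately show ?thesis unfolding r_def using mult_minus_distrib_mat_vec[OF U x' mc[OF B]] by simp
  qed
  have "(norm2_vec (x - prolongation d n p *\<^sub>v y))\<^sup>2 = (\<Sum>j<2 * k. (norm2_vec (?b j r))\<^sup>2)"
    unfolding res using norm2_block_fourier[OF n0 r] norm2_vec_blocks[OF r] by (simp add: U_def n)
  also have "\<dots> = (\<Sum>j<k. (norm2_vec (?b j r))\<^sup>2 + (norm2_vec (?b (j + k) r))\<^sup>2)" by (rule sum_half_split)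
  also have "\<dots> \<le> (\<Sum>j<k. \<gamma> * (quad_form (f (\<theta> j)) (?b j x') + quad_form (f (\<theta> (j + k))) (?b (j + k) x')))"
  proof (rule sum_mono)
    fix j assume "j \<in> {..<k}"
    then show "(norm2_vec (?b j r))\<^sup>2 + (norm2_vec (?b (j + k) r))\<^sup>2
      \<le> \<gamma> * (quad_form (f (\<theta> j)) (?b j x') + quad_form (f (\<theta> (j + k))) (?b (j + k) x'))"
      using W[of j] n by (simp add: good_def rb)
  qed
  also have "\<dots> = \<gamma> * (\<Sum>j<2 * k. quad_form (f (\<theta> j)) (?b j x'))"
    by (simp only: sum_half_split sum_distrib_left)
  also have "\<dots> = \<gamma> * quad_form (block_circulant d n f) x"
    unfolding quad_form_block_circulant[OF n0 f x] by (simp add: x'_def U_def \<theta>_def n)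
  finally have bound: "(norm2_vec (x - prolongation d n p *\<^sub>v y))\<^sup>2 \<le> \<gamma> * quad_form (block_circulant d n f) x" .
  \<comment> \<open>By the local normal equations the blocks j and j + k of \<open>s\<close> are
    opposite. Hence \<open>U *\<^sub>v s\<close> vanishes at even positions while upsampled vectors
    vanish at odd ones, which makes the residual orthogonal to the range of the
    prolongation.\<close>
  define s where "s = mat_adjoint B *\<^sub>v r"
  have s: "s \<in> carrier_vec (n * d)" unfolding s_def by (rule mc[OF B'])
  have sb: "?b (j + k) s = (- 1) \<cdot>\<^sub>v ?b j s" if j: "j < k" for j
  proof -
    have "j < n" "j + k < n" using j n by auto
    then have "?b j s + ?b (j + k) s = 0\<^sub>v d"
      using W[OF j] j unfolding s_def by (simp add: B'b[OF r] rb good_def)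
    then have "(?b j s + ?b (j + k) s) $ a = 0" if "a < d" for a using that by simp
    then show ?thesis by (intro eq_vecI) (auto simp: eq_neg_iff_add_eq_0 add.commute)
  qed
  have orth: "(prolongation d n p *\<^sub>v v) \<bullet>c (U *\<^sub>v r) = 0" if v: "v \<in> carrier_vec (k * d)" for v
  proof -
    have "(prolongation d n p *\<^sub>v v) \<bullet>c (U *\<^sub>v r) = (B *\<^sub>v (mat_adjoint U *\<^sub>v (K *\<^sub>v v))) \<bullet>c (mat_adjoint U *\<^sub>v (U *\<^sub>v r))"
      unfolding Pv[OF v] by (rule cscalar_prod_adjoint[OF U mc[OF B] mc[OF U]])
    also have "mat_adjoint U *\<^sub>v (U *\<^sub>v r) = r" using assoc_mult_mat_vec[OF U' U r] UU r by simp
    also have "(B *\<^sub>v (mat_adjoint U *\<^sub>v (K *\<^sub>v v))) \<bullet>c r = (mat_adjoint U *\<^sub>v (K *\<^sub>v v)) \<bullet>c s"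
      unfolding s_def by (rule cscalar_prod_adjoint[OF B mc[OF U'] r])
    also have "\<dots> = (K *\<^sub>v v) \<bullet>c (U *\<^sub>v s)"
      using cscalar_prod_adjoint[OF U' mc[OF K] s] by simp
    also have "\<dots> = (\<Sum>i<n. ?b i (K *\<^sub>v v) \<bullet>c ?b i (U *\<^sub>v s))"
      by (rule cscalar_prod_blocks[OF mc[OF K] mc[OF U]])
    also have "\<dots> = 0"
    proof (rule sum.neutral, rule ballI)
      fix i assume "i \<in> {..<n}"
      then have i: "i < n" by simp
      show "?b i (K *\<^sub>v v) \<bullet>c ?b i (U *\<^sub>v s) = 0"
      proof (cases "even i")
        case True
        have "?b i (U *\<^sub>v s) = 0\<^sub>v d" unfolding U_def
          by (rule block_fourier_parity[OF n s sb i]) (use True in simp_all)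
        then show ?thesis by (simp add: cscalar_prod_sum)
      next
        case False
        then have "?b i (K *\<^sub>v v) = 0\<^sub>v d" using upsampling_block[OF n v i] by (simp add: K_def)
        then show ?thesis by (simp add: cscalar_prod_sum)
      qed
    qed
    finally show ?thesis .
  qed
  have minimal: "(norm2_vec (x - prolongation d n p *\<^sub>v y))\<^sup>2 \<le> (norm2_vec (x - prolongation d n p *\<^sub>v z))\<^sup>2"
    if z: "z \<in> carrier_vec (k * d)" for z
  proof -
    let ?P = "prolongation d n p"
    have yz: "y - z \<in> carrier_vec (k * d)" using y z by simp
    \<comment> \<open>Pythagoras: any other candidate adds a component in the range of
      \<open>?P\<close>, orthogonal to the residual of \<open>y\<close>.\<close>
    have "x - ?P *\<^sub>v z = ?P *\<^sub>v (y - z) + (x - ?P *\<^sub>v y)"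
      unfolding mult_minus_distrib_mat_vec[OF Pc y z]
      using mc[OF Pc, of y] mc[OF Pc, of z] x by (intro eq_vecI) auto
    then have "(norm2_vec (x - ?P *\<^sub>v z))\<^sup>2 = (norm2_vec (?P *\<^sub>v (y - z)))\<^sup>2 + (norm2_vec (U *\<^sub>v r))\<^sup>2"
      using norm2_vec_add_sq[OF mc[OF Pc] mc[OF U], of "y - z" r] orth[OF yz] by (simp add: res)
    then show ?thesis by (simp add: res)
  qed
  show ?thesis
  proof (intro exI conjI)
    show "is_arg_min (\<lambda>y. (norm2_vec (x - prolongation d n p *\<^sub>v y))\<^sup>2) (\<lambda>y. y \<in> carrier_vec (k * d)) y"
      using y minimal by (auto simp: is_arg_min_def not_less)
  qed (rule bound)
qed

theorem theorem2:
  fixes d :: nat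
    and f p :: "real \<Rightarrow> complex mat"
  assumes "d \<ge> 1"
    and "trig_poly d f"
    and "\<forall>\<theta>. nonneg_definite (f \<theta>)"
    and "\<forall>\<theta> \<in> singular_angles f. \<forall>l. eigenvalue (f (\<theta> + pi)) l \<longrightarrow> l \<noteq> 0"
    and "trig_poly d p"
    and "\<forall>\<theta>. diagonalizable (p \<theta>)"
    and "\<exists>\<delta> > 0. \<forall>\<theta> \<in> {0..<2 * pi} - singular_angles f.
           norm1_mat (inv_sqrt (f \<theta>) * mat_adjoint (p (\<theta> + pi))) < \<delta>"
    and "\<forall>\<theta> \<in> {0..<2 * pi}.
           pos_definite (mat_adjoint (p \<theta>) * p \<theta> + mat_adjoint (p (\<theta> + pi)) * p (\<theta> + pi))"
    and "\<forall>\<theta> \<in> {0..<2 * pi}. p \<theta> * p (\<theta> + pi) = p (\<theta> + pi) * p \<theta>"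
  shows "\<exists>\<gamma> > 0. \<forall>(t::nat) n. t \<ge> 1 \<longrightarrow> n = 2 ^ t \<longrightarrow>
           (\<forall>x \<in> carrier_vec (d * n). \<exists>y.
              is_arg_min (\<lambda>y. (norm2_vec (x - prolongation d n p *\<^sub>v y))\<^sup>2)
                         (\<lambda>y. y \<in> carrier_vec (d * (n div 2))) y \<and>
              (norm2_vec (x - prolongation d n p *\<^sub>v y))\<^sup>2
                \<le> \<gamma> * sqnorm_wrt (block_circulant d n f) x)"
proof -
  from symbol_approximation[OF assms(2-9)] obtain \<gamma> where \<gamma>: "\<gamma> > 0" and
    loc: "\<forall>\<theta> \<in> {0..<2 * pi}. \<forall>x \<in> carrier_vec d. \<forall>y \<in> carrier_vec d. \<exists>w \<in> carrier_vec d.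
      mat_adjoint (p \<theta>) *\<^sub>v (x - p \<theta> *\<^sub>v w) + mat_adjoint (p (\<theta> + pi)) *\<^sub>v (y - p (\<theta> + pi) *\<^sub>v w) = 0\<^sub>v d \<and>
      (norm2_vec (x - p \<theta> *\<^sub>v w))\<^sup>2 + (norm2_vec (y - p (\<theta> + pi) *\<^sub>v w))\<^sup>2
        \<le> \<gamma> * (quad_form (f \<theta>) x + quad_form (f (\<theta> + pi)) y)" by blast
  show ?thesis
  proof (intro exI[of _ \<gamma>] conjI \<gamma> allI impI ballI)
    fix t n :: nat and x :: "complex vec"
    assume t: "t \<ge> 1" and nt: "n = 2 ^ t" and x: "x \<in> carrier_vec (d * n)"
    define k where "k = n div 2"
    \<comment> \<open>t \<ge> 1 makes n even, so the k pairs of opposite frequencies exhaust the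
      grid.\<close>
    have "n = 2 * 2 ^ (t - 1)" using t nt by (simp add: power_eq_if)
    then have k: "k > 0" "n = 2 * k" by (simp_all add: k_def)
    have x': "x \<in> carrier_vec (n * d)" using x by (simp add: mult.commute)
    from two_grid_approximation[OF k trig_poly_carrier[OF assms(2)] trig_poly_carrier[OF assms(5)] loc x']
    show "\<exists>y. is_arg_min (\<lambda>y. (norm2_vec (x - prolongation d n p *\<^sub>v y))\<^sup>2)
             (\<lambda>y. y \<in> carrier_vec (d * (n div 2))) y \<and>
        (norm2_vec (x - prolongation d n p *\<^sub>v y))\<^sup>2 \<le> \<gamma> * sqnorm_wrt (block_circulant d n f) x"
      by (simp only: k_def mult.commute)
  qed
qed

end
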